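(* For all positive integers $k, r$ with $k\geq 3$, the number $\frac{r-1}{r}$ is an accumulation point of the set $$\Gamma^{(k)}=\{\gamma(F) : F \text{ is a } k\text{-graph}\}\subseteq[0,1),$$ where $\gamma(F)$ denotes the codegree Turán density of $F$.
   Context: A $k$-uniform hypergraph (or $k$-graph) $H$ consists of a finite vertex set $V(H)$ together with a set of edges $E(H)\subseteq V(H)^{(k)}=\{S\subseteq V(H): |S|=k\}$. A copy of a $k$-graph $F$ in a $k$-graph $H$ is a (not necessarily induced) subhypergraph of $H$ isomorphic to $F$. That is, $H$ contains a copy of $F$ if there is an injective map $\varphi: V(F)\to V(H)$ with $\varphi(e)\in E(H)$ for all $e\in E(F)$. $H$ is called $F$-free if it contains no copy of $F$. For a $k$-graph $H$ and $S\subseteq V(H)$, the degree of $S$ is $d(S)=|\{e\in E(H): S\subseteq e\}|$. The minimum codegree of $H$ is $\delta(H)=\min_{S\in V(H)^{(k-1)}} d(S)$, the minimum of $d(S)$ over all $(k-1)$-element subsets $S$ of $V(H)$. Given a $k$-graph $F$ and a positive integer $n$, the codegree Turán number $\mathrm{ex}_{\mathrm{co}}(n,F)$ is the maximum $d$ such that there is an $F$-free $k$-graph $H$ on $n$ vertices with $\delta(H)\geq d$ (in the degenerate case where no $F$-free $k$-graph on $n$ vertices exists, which for large $n$ happens only if $F$ has no edges, this is taken to be $0$). The codegree Turán density of $F$ is $$\gamma(F)=\lim_{n\to\infty}\frac{\mathrm{ex}_{\mathrm{co}}(n,F)}{n};$$ this limit is known to always exist (Mubayi and Zhao), and $\gamma(F)\in[0,1)$.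 A real number $x$ is an accumulation point of a set $A\subseteq\mathbb{R}$ if for every $\varepsilon>0$ there is some $a\in A$ with $0<|a-x|<\varepsilon$. *)

theory Defs
  imports "HOL-Analysis.Analysis" "HOL-Library.Ramsey"
begin

record 'a hypergraph =
  verts :: "'a set"
  edges :: "'a set set"

definition uniform_hypergraph :: "nat \<Rightarrow> 'a hypergraph \<Rightarrow> bool" where
  "uniform_hypergraph k H \<longleftrightarrow> finite (verts H) \<and> edges H \<subseteq> nsets (verts H) k"

definition contains_copy :: "'a hypergraph \<Rightarrow> 'b hypergraph \<Rightarrow> bool" where
  "contains_copy H F \<longleftrightarrow>
     (\<exists>\<phi>. inj_on \<phi> (verts F) \<and> \<phi> ` verts F \<subseteq> verts H \<and> (\<forall>e\<in>edges F. \<phi> ` e \<in> edges H))"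

definition degree_of :: "'a hypergraph \<Rightarrow> 'a set \<Rightarrow> nat" where
  "degree_of H S = card {e \<in> edges H. S \<subseteq> e}"

text \<open>If \<open>H\<close> has fewer than \<open>k - 1\<close> vertices, the minimum ranges over the empty set; we take
  it to be 0. This has no influence on the codegree density.\<close>

definition min_codegree :: "nat \<Rightarrow> 'a hypergraph \<Rightarrow> nat" where
  "min_codegree k H =
     (if nsets (verts H) (k - 1) = {} then 0
      else Min (degree_of H ` nsets (verts H) (k - 1)))"

text \<open>All hypergraphs here are finite, so up to isomorphism it suffices to let the host
  hypergraphs, and below also the forbidden ones, have vertices in \<^typ>\<open>nat\<close>.
  The set of attainable \<open>d\<close> is bounded, so \<open>Max\<close> is the maximum.\<close>

definition ex_co :: "nat \<Rightarrow> nat \<Rightarrow> 'a hypergraph \<Rightarrow> nat" where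
  "ex_co k n F =
     (let D = {d. \<exists>H :: nat hypergraph. uniform_hypergraph k H \<and> card (verts H) = n \<and>
                    \<not> contains_copy H F \<and> min_codegree k H \<ge> d}
      in if D = {} then 0 else Max D)"

definition codegree_density :: "nat \<Rightarrow> 'a hypergraph \<Rightarrow> real" where
  "codegree_density k F = lim (\<lambda>n. real (ex_co k n F) / real n)"

definition codegree_densities :: "nat \<Rightarrow> real set" where
  "codegree_densities k =
     {codegree_density k F | F :: nat hypergraph. uniform_hypergraph k F}"

end

theory Submission
  imports Defs
begin

text \<open>Fix \<open>\<alpha>\<close> slightly larger than \<open>(r - 1) / r\<close> and a large \<open>m\<close>. In a \<open>k\<close>-graph on \<open>m\<close> vertices with
  codegree at least \<open>\<alpha> m\<close>, any \<open>r\<close> sets of size \<open>k - 1\<close> have many common neighbours. Let \<open>F\<close> be the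
  categorical product of all \<open>k\<close>-graphs on \<open>m\<close> vertices with the latter property. It maps
  homomorphically to each of them, so sampling and blowing up give \<open>\<gamma>(F) \<le> \<alpha> + o(1)\<close>.

  Write \<open>S \<rightarrow> S'\<close> for \<open>(k - 1)\<close>-sets if \<open>S \<union> {v}\<close> is an edge for all \<open>v \<in> S'\<close>. The common
  neighbourhood property is inherited by \<open>F\<close> and forces, in every \<open>r\<close>-colouring of its vertices, a
  monochromatic closed walk of bounded length for this relation. On the other hand, take \<open>r\<close> classes
  with vertex labels modulo \<open>M\<close>, and let the edges be all \<open>k\<close>-sets that are not inside a class or
  have label sum 1. This has codegree density \<open>(r - 1) / r + 1 / (r M)\<close>. Along a walk inside a class
  the label sum \<open>s\<close> evolves by \<open>s \<mapsto> (k - 1) (1 - s)\<close>, which for suitable \<open>M\<close> has no short cycle,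
  so \<open>F\<close> does not occur and \<open>\<gamma>(F) > (r - 1) / r\<close>.\<close>

section \<open>Codegrees and the extremal function\<close>

definition nbrs :: "'a hypergraph \<Rightarrow> 'a set \<Rightarrow> 'a set" where
  "nbrs H S = {v. insert v S \<in> edges H}"

lemma uniform_edgeD:
  assumes "uniform_hypergraph k H" "e \<in> edges H"
  shows "e \<subseteq> verts H" "finite e" "card e = k"
  using assms by (auto simp: uniform_hypergraph_def nsets_def)

lemma nbrs_subset: "uniform_hypergraph k H \<Longrightarrow> nbrs H S \<subseteq> verts H"
  by (auto simp: nbrs_def dest: uniform_edgeD(1))

lemma finite_nbrs: "uniform_hypergraph k H \<Longrightarrow> finite (nbrs H S)"
  using nbrs_subset[of k H S] finite_subset by (auto simp: uniform_hypergraph_def)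

lemma nbrs_notin:
  assumes "uniform_hypergraph k H" "card S < k" "v \<in> nbrs H S"
  shows "v \<notin> S"
  using uniform_edgeD(3)[OF assms(1), of "insert v S"] assms by (auto simp: nbrs_def insert_absorb)

text \<open>An edge containing \<open>S\<close> has exactly one vertex outside \<open>S\<close>, and
  that vertex determines it. From here on codegrees are sizes of vertex sets, which can be sampled
  and intersected.\<close>

lemma degree_of_eq_card_nbrs:
  assumes H: "uniform_hypergraph k H" and k: "k \<ge> 1" and S: "S \<in> nsets (verts H) (k - 1)"
  shows "degree_of H S = card (nbrs H S)"
proof -
  have fS: "finite S" and cS: "card S = k - 1" using S by (auto simp: nsets_def)
  have "bij_betw (\<lambda>v. insert v S) (nbrs H S) {e \<in> edges H. S \<subseteq> e}"
  proof (rule bij_betw_imageI)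
    show "inj_on (\<lambda>v. insert v S) (nbrs H S)"
    proof (rule inj_onI)
      fix v w assume vw: "v \<in> nbrs H S" "w \<in> nbrs H S" and eq: "insert v S = insert w S"
      have "v \<notin> S" "w \<notin> S" using vw nbrs_notin[OF H] cS k by auto
      with eq show "v = w" by blast
    qed
    show "(\<lambda>v. insert v S) ` nbrs H S = {e \<in> edges H. S \<subseteq> e}"
    proof (intro equalityI subsetI)
      fix e assume e: "e \<in> {e \<in> edges H. S \<subseteq> e}"
      then have "finite e" "card e = k" using uniform_edgeD[OF H] by auto
      then have "card (e - S) = 1" using e fS cS k by (simp add: card_Diff_subset)
      then obtain v where "e - S = {v}" by (auto simp: card_1_singleton_iff)
      then have "e = insert v S" using e by auto
      then show "e \<in> (\<lambda>v. insert v S) ` nbrs H S" using e by (auto simp: nbrs_def)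
    qed (auto simp: nbrs_def)
  qed
  then show ?thesis unfolding degree_of_def by (simp add: bij_betw_same_card)
qed

lemma min_codegree_le:
  assumes H: "uniform_hypergraph k H" and k: "k \<ge> 1" and S: "S \<in> nsets (verts H) (k - 1)"
  shows "min_codegree k H \<le> card (nbrs H S)"
proof -
  have "finite (nsets (verts H) (k - 1))"
    using H by (auto simp: uniform_hypergraph_def intro: finite_imp_finite_nsets)
  then have "min_codegree k H \<le> degree_of H S"
    using S unfolding min_codegree_def by auto
  then show ?thesis using degree_of_eq_card_nbrs[OF assms] by simp
qed

lemma min_codegree_ge:
  assumes H: "uniform_hypergraph k H" and k: "k \<ge> 1" and n: "k - 1 \<le> card (verts H)"
    and d: "\<And>S. S \<in> nsets (verts H) (k - 1) \<Longrightarrow> d \<le> card (nbrs H S)"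
  shows "d \<le> min_codegree k H"
proof -
  have fin: "finite (nsets (verts H) (k - 1))"
    using H by (auto simp: uniform_hypergraph_def intro: finite_imp_finite_nsets)
  have ne: "nsets (verts H) (k - 1) \<noteq> {}"
    using n by (auto simp: nsets_eq_empty_iff)
  show ?thesis
    unfolding min_codegree_def using ne fin d degree_of_eq_card_nbrs[OF H k]
    by auto
qed

lemma min_codegree_le_card:
  assumes H: "uniform_hypergraph k H" and k: "k \<ge> 1"
  shows "min_codegree k H \<le> card (verts H)"
proof (cases "nsets (verts H) (k - 1) = {}")
  case False
  then obtain S where "S \<in> nsets (verts H) (k - 1)" by blast
  from min_codegree_le[OF H k this] show ?thesis
    using card_mono[OF _ nbrs_subset[OF H]] H by (fastforce simp: uniform_hypergraph_def intro: le_trans)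
qed (simp add: min_codegree_def)

lemma ex_co_ge:
  fixes H :: "nat hypergraph"
  assumes H: "uniform_hypergraph k H" and k: "k \<ge> 1" and n: "card (verts H) = n"
    and free: "\<not> contains_copy H F"
  shows "min_codegree k H \<le> ex_co k n F"
proof -
  define D where "D = {d. \<exists>H :: nat hypergraph. uniform_hypergraph k H \<and> card (verts H) = n \<and>
                    \<not> contains_copy H F \<and> min_codegree k H \<ge> d}"
  have "D \<subseteq> {..n}" unfolding D_def using min_codegree_le_card[OF _ k] le_trans by fastforce
  then have fin: "finite D" using finite_subset by blast
  have mem: "min_codegree k H \<in> D" unfolding D_def using assms by blast
  have "ex_co k n F = Max D" using mem unfolding ex_co_def D_def[symmetric] Let_def by auto
  then show ?thesis using Max_ge[OF fin mem] by simp
qed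

text \<open>A positive value cannot be the default 0 of the case without \<open>F\<close>-free
  hosts, so it is attained as a maximum.\<close>

lemma ex_co_witness:
  assumes k: "k \<ge> 1" and pos: "ex_co k n F > 0"
  obtains H :: "nat hypergraph" where "uniform_hypergraph k H" "card (verts H) = n"
    "\<not> contains_copy H F" "ex_co k n F \<le> min_codegree k H"
proof -
  define D where "D = {d. \<exists>H :: nat hypergraph. uniform_hypergraph k H \<and> card (verts H) = n \<and>
                    \<not> contains_copy H F \<and> min_codegree k H \<ge> d}"
  have "D \<subseteq> {..n}" unfolding D_def using min_codegree_le_card[OF _ k] le_trans by fastforce
  then have fin: "finite D" using finite_subset by blast
  have eq: "ex_co k n F = (if D = {} then 0 else Max D)" unfolding ex_co_def D_def[symmetric] Let_def ..
  then have "D \<noteq> {}" using pos by auto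
  then have "ex_co k n F \<in> D" using eq Max_in[OF fin] by auto
  then show thesis using that unfolding D_def by blast
qed

lemma ex_co_le: "k \<ge> 1 \<Longrightarrow> ex_co k n F \<le> n"
  by (metis bot_nat_0.extremum ex_co_witness le_trans min_codegree_le_card not_gr_zero)

text \<open>The product used at the end has functions as vertices, whereas
  \<open>codegree_densities\<close> ranges over hypergraphs on \<open>nat\<close>. Relabelling along
  a bijection does not change which hosts contain a copy, hence no value of
  \<open>ex_co\<close>.\<close>

lemma codegree_density_mem:
  assumes F: "uniform_hypergraph k F"
  shows "codegree_density k F \<in> codegree_densities k"
proof -
  have fin: "finite (verts F)" using F by (simp add: uniform_hypergraph_def)
  obtain b where b: "bij_betw b (verts F) {0..<card (verts F)}"
    using ex_bij_betw_finite_nat[OF fin] by blast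
  have inj: "inj_on b (verts F)" using b by (simp add: bij_betw_def)
  define F' :: "nat hypergraph" where "F' = \<lparr>verts = b ` verts F, edges = (`) b ` edges F\<rparr>"
  have sub: "e \<subseteq> verts F" if "e \<in> edges F" for e using uniform_edgeD[OF F that] by simp
  have F': "uniform_hypergraph k F'"
    using fin uniform_edgeD[OF F] inj
    by (auto simp: uniform_hypergraph_def F'_def nsets_def card_image inj_on_subset)
  have "contains_copy H F' \<longleftrightarrow> contains_copy H F" for H :: "nat hypergraph"
  proof
    assume "contains_copy H F'"
    then obtain p where p: "inj_on p (b ` verts F)" "p ` b ` verts F \<subseteq> verts H"
      "\<forall>e\<in>edges F. p ` b ` e \<in> edges H" by (auto simp: contains_copy_def F'_def)
    show "contains_copy H F"
      unfolding contains_copy_def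
      by (rule exI[of _ "p \<circ> b"]) (use p inj in \<open>auto simp: comp_inj_on image_comp\<close>)
  next
    assume "contains_copy H F"
    then obtain p where p: "inj_on p (verts F)" "p ` verts F \<subseteq> verts H"
      "\<forall>e\<in>edges F. p ` e \<in> edges H" by (auto simp: contains_copy_def)
    define q where "q = inv_into (verts F) b"
    have q: "q (b v) = v" if "v \<in> verts F" for v using inj that by (simp add: q_def)
    have img: "(p \<circ> q) ` b ` e = p ` e" if "e \<subseteq> verts F" for e
      using q that by (force simp: image_iff)
    show "contains_copy H F'"
      unfolding contains_copy_def
    proof (intro exI conjI ballI)
      show "inj_on (p \<circ> q) (verts F')" using p(1) q by (auto simp: F'_def inj_on_def)
      show "(p \<circ> q) ` verts F' \<subseteq> verts H" using img[of "verts F"] p by (simp add: F'_def)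
      show "(p \<circ> q) ` e \<in> edges H" if e: "e \<in> edges F'" for e
      proof -
        obtain e' where "e' \<in> edges F" "e = b ` e'" using e by (auto simp: F'_def)
        then show ?thesis using img[of e'] sub p(3) by simp
      qed
    qed
  qed
  then have "ex_co k n F' = ex_co k n F" for n
    unfolding ex_co_def by simp
  then have "codegree_density k F' = codegree_density k F"
    unfolding codegree_density_def by simp
  then show ?thesis using F' unfolding codegree_densities_def by (metis (mono_tags, lifting) mem_Collect_eq)
qed

section \<open>Random sampling\<close>

text \<open>An ordered sample of \<open>m\<close> vertices of \<open>G\<close>, read back on the
  fixed vertex set \<open>{..<m}\<close>. For given \<open>m\<close> only finitely many outcomes are
  possible, which later permits pigeonholing over them.\<close>

definition pullback :: "nat \<Rightarrow> nat \<Rightarrow> 'a hypergraph \<Rightarrow> (nat \<Rightarrow> 'a) \<Rightarrow> nat hypergraph" where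
  "pullback k m G f = \<lparr>verts = {..<m}, edges = {e \<in> nsets {..<m} k. f ` e \<in> edges G}\<rparr>"

lemma verts_pullback [simp]: "verts (pullback k m G f) = {..<m}"
  by (simp add: pullback_def)

lemma uniform_pullback: "uniform_hypergraph k (pullback k m G f)"
  by (auto simp: pullback_def uniform_hypergraph_def)

lemma contains_copy_pullback:
  assumes f: "f \<in> {..<m} \<rightarrow> verts G" "inj_on f {..<m}" and "contains_copy (pullback k m G f) F"
  shows "contains_copy G F"
proof -
  obtain p where p: "inj_on p (verts F)" "p ` verts F \<subseteq> {..<m}"
    "\<And>e. e \<in> edges F \<Longrightarrow> f ` p ` e \<in> edges G"
    using assms(3) by (auto simp: contains_copy_def pullback_def)
  show ?thesis unfolding contains_copy_def
    by (rule exI[of _ "f \<circ> p"])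
       (use p f in \<open>auto simp: image_image intro!: comp_inj_on intro: inj_on_subset\<close>)
qed

lemma exp_minus_le_quadratic:
  fixes s :: real assumes "0 \<le> s" shows "exp (- s) \<le> 1 - s + s\<^sup>2 / 2"
proof -
  \<comment> \<open>The product on the right equals 1 + s^4 / 4.\<close>
  have "1 \<le> (1 - s + s\<^sup>2 / 2) * (1 + s + s\<^sup>2 / 2)"
    using assms by (simp add: algebra_simps power2_eq_square)
  also have "\<dots> \<le> (1 - s + s\<^sup>2 / 2) * exp s"
  proof (rule mult_left_mono)
    show "1 + s + s\<^sup>2 / 2 \<le> exp s" using exp_lower_Taylor_quadratic[OF assms] by simp
    have "1 - s + s\<^sup>2 / 2 = ((1 - s)\<^sup>2 + 1) / 2" by (simp add: power2_eq_square field_simps)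
    then show "0 \<le> 1 - s + s\<^sup>2 / 2" by (metis add_nonneg_nonneg divide_nonneg_nonneg zero_le_numeral zero_le_one zero_le_power2)
  qed
  finally show ?thesis by (simp add: exp_minus field_simps)
qed

text \<open>Chernoff's method: weight \<open>f\<close> by \<open>exp (- s)\<close> for every hit and factor the total weight.\<close>

lemma card_few_hits:
  fixes V :: "'a set" and s t :: real
  assumes V: "finite V" and I: "I \<subseteq> {..<m}" and g: "g \<in> PiE I (\<lambda>_. V)" and N: "N \<subseteq> V"
    and d: "d \<le> card N" and s: "0 \<le> s"
  shows "real (card {f \<in> PiE {..<m} (\<lambda>_. V). restrict f I = g \<and>
            real (card {i \<in> {..<m} - I. f i \<in> N}) \<le> t})
         \<le> exp (s * t) * (real (card V) - real d * (1 - exp (- s))) ^ (m - card I)"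
    (is "real (card ?B) \<le> _")
proof -
  \<comment> \<open>On \<open>I\<close> the only admissible value is that of \<open>g\<close>. The
    functions extending \<open>g\<close> thus form a full product, over which the total weight
    factors.\<close>
  define A where "A = (\<lambda>i. if i \<in> I then {g i} else V)"
  define w :: "nat \<Rightarrow> 'a \<Rightarrow> real" where "w = (\<lambda>i v. if i \<notin> I \<and> v \<in> N then exp (- s) else 1)"
  have finI: "finite I" using I finite_subset by blast
  have finN: "finite N" using N V finite_subset by blast
  have finP: "finite (PiE {..<m} A)" using V by (intro finite_PiE) (auto simp: A_def)
  have BA: "?B \<subseteq> PiE {..<m} A"
  proof
    fix f assume "f \<in> ?B"
    then have f: "f \<in> PiE {..<m} (\<lambda>_. V)" and r: "restrict f I = g" by blast+
    have "f i = g i" if "i \<in> I" for i using fun_cong[OF r, of i] that by simp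
    then show "f \<in> PiE {..<m} A" using f by (simp add: A_def PiE_iff)
  qed
  have hits: "(\<Prod>i<m. w i (f i)) = exp (- s * card {i \<in> {..<m} - I. f i \<in> N})" for f
  proof -
    have "(\<Prod>i<m. w i (f i)) = (\<Prod>i\<in>{i \<in> {..<m} - I. f i \<in> N}. exp (- s))"
      unfolding w_def by (rule prod.mono_neutral_cong_right) auto
    also have "\<dots> = exp (- s * card {i \<in> {..<m} - I. f i \<in> N})"
      by (simp add: exp_of_nat_mult[symmetric] mult.commute)
    finally show ?thesis .
  qed
  have w0: "0 \<le> w i v" for i v by (simp add: w_def)
  have wV: "(\<Sum>v\<in>V. w i v) \<le> real (card V) - real d * (1 - exp (- s))" if "i \<notin> I" for i
  proof -
    have "(\<Sum>v\<in>V. w i v) = (\<Sum>v\<in>V. 1 - (if v \<in> N then 1 - exp (- s) else 0))"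
      using that by (intro sum.cong) (auto simp: w_def)
    also have "\<dots> = real (card V) - (\<Sum>v\<in>V. if v \<in> N then 1 - exp (- s) else 0)"
      by (simp add: sum_subtractf)
    also have "(\<Sum>v\<in>V. if v \<in> N then 1 - exp (- s) else 0) = real (card N) * (1 - exp (- s))"
      using N V by (simp add: sum.If_cases Int_absorb1)
    also have "real (card V) - real (card N) * (1 - exp (- s)) \<le> real (card V) - real d * (1 - exp (- s))"
      using d s by (simp add: mult_right_mono)
    finally show ?thesis .
  qed
  have "real (card ?B) * exp (- s * t) = (\<Sum>f\<in>?B. exp (- s * t))" by simp
  also have "\<dots> \<le> (\<Sum>f\<in>?B. \<Prod>i<m. w i (f i))"
    by (rule sum_mono) (use s in \<open>auto simp: hits mult_left_mono\<close>)
  also have "\<dots> \<le> (\<Sum>f\<in>PiE {..<m} A. \<Prod>i<m. w i (f i))"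
    by (rule sum_mono2[OF finP BA]) (simp add: hits)
  also have "\<dots> = (\<Prod>i<m. \<Sum>v\<in>A i. w i v)"
    by (rule prod_sum_PiE[symmetric]) (use V in \<open>auto simp: A_def\<close>)
  also have "\<dots> = (\<Prod>i\<in>{..<m} - I. \<Sum>v\<in>V. w i v)"
    by (rule prod.mono_neutral_cong_right) (auto simp: A_def w_def)
  also have "\<dots> \<le> (\<Prod>i\<in>{..<m} - I. real (card V) - real d * (1 - exp (- s)))"
    by (rule prod_mono) (auto simp: wV w0 intro!: sum_nonneg)
  also have "\<dots> = (real (card V) - real d * (1 - exp (- s))) ^ (m - card I)"
    using I finI by (simp add: card_Diff_subset)
  finally have "real (card ?B) * exp (- s * t) \<le> \<dots>" .
  then show ?thesis by (simp add: exp_minus field_simps)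
qed

text \<open>The weight parameter is taken as s = \<epsilon>. With b = d / n the exponent becomes
  \<epsilon> (b - \<epsilon>) m - b (\<epsilon> - \<epsilon>^2 / 2) (m - |I|), and 0 \<le> b \<le> 1
  bounds it by |I| - \<epsilon>^2 m / 2. The term |I| pays for the fixed coordinates, where no hits
  are counted.\<close>

lemma card_few_hits_exp:
  fixes V :: "'a set" and \<epsilon> :: real
  assumes V: "finite V" "card V = n" "n > 0" and I: "I \<subseteq> {..<m}" and g: "g \<in> PiE I (\<lambda>_. V)"
    and N: "N \<subseteq> V" and d: "d \<le> card N" and e: "0 < \<epsilon>" "\<epsilon> \<le> 1"
  shows "real (card {f \<in> PiE {..<m} (\<lambda>_. V). restrict f I = g \<and>
            real (card {i \<in> {..<m} - I. f i \<in> N}) \<le> (real d / real n - \<epsilon>) * real m})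
         \<le> real n ^ (m - card I) * exp (real (card I) - \<epsilon>\<^sup>2 / 2 * real m)"
proof -
  define b where "b = real d / real n"
  have "card N \<le> n" using N V card_mono by blast
  then have b: "0 \<le> b" "b \<le> 1" using d V by (auto simp: b_def)
  have cI: "card I \<le> m" using card_mono[OF _ I] by simp
  have "\<epsilon>\<^sup>2 / 2 \<le> \<epsilon>" using mult_left_le[of \<epsilon> \<epsilon>] e by (simp add: power2_eq_square)
  define q where "q = b * (\<epsilon> - \<epsilon>\<^sup>2 / 2)"
  have "\<epsilon> - \<epsilon>\<^sup>2 / 2 \<le> 1" using e zero_le_power2[of \<epsilon>] by linarith
  then have q: "0 \<le> q" "q \<le> 1"
    using b \<open>\<epsilon>\<^sup>2 / 2 \<le> \<epsilon>\<close> by (auto simp: q_def intro!: mult_le_one)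
  have dn: "real d = b * real n" using V by (simp add: b_def)
  have "real n - real d * (1 - exp (- \<epsilon>)) \<le> real n - real d * (\<epsilon> - \<epsilon>\<^sup>2 / 2)"
    using exp_minus_le_quadratic[of \<epsilon>] e by (intro diff_left_mono mult_left_mono) auto
  also have "\<dots> = real n * (1 - q)" by (simp add: dn q_def algebra_simps)
  also have "\<dots> \<le> real n * exp (- q)"
    using exp_ge_add_one_self[of "- q"] by (intro mult_left_mono) auto
  finally have le: "real n - real d * (1 - exp (- \<epsilon>)) \<le> real n * exp (- q)" .
  have "real d * (1 - exp (- \<epsilon>)) \<le> real n * 1"
    using e d \<open>card N \<le> n\<close> by (intro mult_mono) auto
  then have nn: "0 \<le> real n - real d * (1 - exp (- \<epsilon>))" by simp
  have "real (card {f \<in> PiE {..<m} (\<lambda>_. V). restrict f I = g \<and>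
            real (card {i \<in> {..<m} - I. f i \<in> N}) \<le> (real d / real n - \<epsilon>) * real m})
       \<le> exp (\<epsilon> * ((b - \<epsilon>) * real m)) * (real n - real d * (1 - exp (- \<epsilon>))) ^ (m - card I)"
    using card_few_hits[OF V(1) I g N d, of \<epsilon> "(b - \<epsilon>) * real m"] e unfolding b_def V(2) by simp
  also have "\<dots> \<le> exp (\<epsilon> * ((b - \<epsilon>) * real m)) * (real n * exp (- q)) ^ (m - card I)"
    using nn le by (intro mult_left_mono power_mono) auto
  also have "\<dots> = real n ^ (m - card I) * exp (\<epsilon> * ((b - \<epsilon>) * real m) - q * (real m - real (card I)))"
  proof -
    have "exp (- q) ^ (m - card I) = exp (- (q * (real m - real (card I))))"
      using cI by (simp add: exp_of_nat_mult[symmetric] of_nat_diff mult.commute)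
    then show ?thesis by (simp add: power_mult_distrib mult_exp_exp)
  qed
  also have "\<dots> \<le> real n ^ (m - card I) * exp (real (card I) - \<epsilon>\<^sup>2 / 2 * real m)"
  proof -
    have "\<epsilon> * ((b - \<epsilon>) * real m) - q * (real m - real (card I))
        = b * (\<epsilon>\<^sup>2 / 2 * real m) - \<epsilon>\<^sup>2 * real m + q * real (card I)"
      by (simp add: q_def algebra_simps add_divide_distrib diff_divide_distrib power2_eq_square)
    also have "\<dots> \<le> 1 * (\<epsilon>\<^sup>2 / 2 * real m) - \<epsilon>\<^sup>2 * real m + 1 * real (card I)"
      using b q by (intro add_mono diff_mono mult_right_mono) auto
    finally show ?thesis by (intro mult_left_mono) (auto simp: algebra_simps)
  qed
  finally show ?thesis .
qed

text \<open>Birthday bound: there are at most m^2 pairs of indices, and each collides in at most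
  n^(m - 1) functions, since one of the two values determines the other.\<close>

lemma card_not_inj:
  fixes V :: "'a set"
  assumes V: "finite V" "card V = n" and n: "4 * m\<^sup>2 \<le> n"
  shows "real (card {f \<in> PiE {..<m} (\<lambda>_. V). \<not> inj_on f {..<m}}) \<le> real n ^ m / 4"
proof -
  let ?P = "PiE {..<m} (\<lambda>_. V)"
  have finP: "finite ?P" using V by (intro finite_PiE) auto
  define X where "X = {(i, j) \<in> {..<m} \<times> {..<m}. i \<noteq> j}"
  have finX: "finite X" by (rule finite_subset[of _ "{..<m} \<times> {..<m}"]) (auto simp: X_def)
  have cX: "card X \<le> m\<^sup>2"
    using card_mono[of "{..<m} \<times> {..<m}" X] by (auto simp: X_def power2_eq_square)
  have one: "card {f \<in> ?P. f i = f j} \<le> n ^ (m - 1)" if "(i, j) \<in> X" for i j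
  proof -
    have "card {f \<in> ?P. f i = f j} \<le> card (PiE ({..<m} - {j}) (\<lambda>_. V))"
    proof (rule card_inj_on_le)
      show "inj_on (\<lambda>f. restrict f ({..<m} - {j})) {f \<in> ?P. f i = f j}"
      proof (rule inj_onI)
        fix f h assume f: "f \<in> {f \<in> ?P. f i = f j}" and h: "h \<in> {f \<in> ?P. f i = f j}"
          and eq: "restrict f ({..<m} - {j}) = restrict h ({..<m} - {j})"
        have *: "f x = h x" if "x \<in> {..<m} - {j}" for x
          using fun_cong[OF eq, of x] that by simp
        have "f x = h x" if "x \<in> {..<m}" for x
        proof (cases "x = j")
          case True then show ?thesis using *[of i] f h \<open>(i, j) \<in> X\<close> by (auto simp: X_def)
        qed (use * that in auto)
        then show "f = h" using f h by (intro PiE_ext[of f "{..<m}" "\<lambda>_. V" h]) auto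
      qed
      show "(\<lambda>f. restrict f ({..<m} - {j})) ` {f \<in> ?P. f i = f j} \<subseteq> PiE ({..<m} - {j}) (\<lambda>_. V)"
        by (simp add: image_subset_iff PiE_iff)
      show "finite (PiE ({..<m} - {j}) (\<lambda>_. V))" using V by (simp add: finite_PiE)
    qed
    also have "\<dots> = n ^ (m - 1)" using that V by (simp add: card_PiE X_def)
    finally show ?thesis .
  qed
  have "{f \<in> ?P. \<not> inj_on f {..<m}} \<subseteq> (\<Union>(i, j)\<in>X. {f \<in> ?P. f i = f j})"
    by (auto simp: inj_on_def X_def)
  then have "card {f \<in> ?P. \<not> inj_on f {..<m}} \<le> card (\<Union>(i, j)\<in>X. {f \<in> ?P. f i = f j})"
    using finX finP by (intro card_mono) auto
  also have "\<dots> \<le> (\<Sum>x\<in>X. card (case x of (i, j) \<Rightarrow> {f \<in> ?P. f i = f j}))"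
    using finX by (rule card_UN_le)
  also have "\<dots> \<le> (\<Sum>x\<in>X. n ^ (m - 1))"
    using one by (intro sum_mono) auto
  also have "\<dots> \<le> m\<^sup>2 * n ^ (m - 1)" using cX by simp
  finally have "4 * card {f \<in> ?P. \<not> inj_on f {..<m}} \<le> 4 * m\<^sup>2 * n ^ (m - 1)" by simp
  also have "\<dots> \<le> n ^ m"
  proof (cases m)
    case (Suc m')
    then show ?thesis using mult_right_mono[OF n, of "n ^ m'"] by simp
  qed simp
  finally have "real (4 * card {f \<in> ?P. \<not> inj_on f {..<m}}) \<le> real (n ^ m)"
    by (simp only: of_nat_le_iff)
  then show ?thesis by simp
qed

text \<open>With \<open>j = k - 1\<close> this absorbs the union bound over all
  \<open>(k - 1)\<close>-subsets of a sample.\<close>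

lemma eventually_poly_exp_small:
  fixes c :: real assumes c: "c > 0"
  shows "\<exists>m0. \<forall>m\<ge>m0. real m ^ j * exp (real j - c * real m) \<le> 1 / 4"
proof -
  have "((\<lambda>x. x ^ j / exp x) \<longlongrightarrow> (0::real)) at_top" by (rule tendsto_power_div_exp_0)
  moreover have "filterlim (\<lambda>m. c * real m) at_top sequentially"
    using c by (intro filterlim_tendsto_pos_mult_at_top[OF tendsto_const] filterlim_real_sequentially)
  ultimately have "(\<lambda>m. (c * real m) ^ j / exp (c * real m)) \<longlonglongrightarrow> 0"
    by (rule filterlim_compose)
  then have "(\<lambda>m. exp (real j) / c ^ j * ((c * real m) ^ j / exp (c * real m))) \<longlonglongrightarrow> exp (real j) / c ^ j * 0"
    by (rule tendsto_mult_left)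
  also have "(\<lambda>m. exp (real j) / c ^ j * ((c * real m) ^ j / exp (c * real m)))
      = (\<lambda>m. real m ^ j * exp (real j - c * real m))"
    using c by (auto simp: fun_eq_iff power_mult_distrib exp_diff field_simps)
  finally have "(\<lambda>m. real m ^ j * exp (real j - c * real m)) \<longlonglongrightarrow> 0" by simp
  then have "eventually (\<lambda>m. real m ^ j * exp (real j - c * real m) < 1 / 4) sequentially"
    by (rule order_tendstoD) simp
  then show ?thesis unfolding eventually_sequentially by (meson less_imp_le)
qed

text \<open>Union bound: at most a quarter of all functions are not injective, and at most a quarter
  are injective but give some \<open>(k - 1)\<close>-set \<open>I\<close> of indices too small a
  codegree. For a given \<open>I\<close>, condition on the restriction of \<open>f\<close> to
  \<open>I\<close>: its image has codegree at least \<open>d\<close> in \<open>G\<close>, so the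
  tail bound applies to the remaining coordinates. The threshold \<open>m0\<close> does not depend
  on \<open>G\<close>.\<close>

lemma sampling:
  fixes \<epsilon> :: real
  assumes k: "k \<ge> 1" and e: "0 < \<epsilon>" "\<epsilon> \<le> 1"
  shows "\<exists>m0. \<forall>m n d (G :: 'a hypergraph). m0 \<le> m \<longrightarrow> 4 * m\<^sup>2 \<le> n \<longrightarrow> uniform_hypergraph k G \<longrightarrow>
     card (verts G) = n \<longrightarrow> d \<le> min_codegree k G \<longrightarrow>
     real n ^ m / 2 \<le> real (card {f \<in> PiE {..<m} (\<lambda>_. verts G). inj_on f {..<m} \<and>
        (real d / real n - \<epsilon>) * real m \<le> min_codegree k (pullback k m G f)})"
proof -
  obtain m0 where m0: "\<And>m. m0 \<le> m \<Longrightarrow> real m ^ (k - 1) * exp (real (k - 1) - \<epsilon>\<^sup>2 / 2 * real m) \<le> 1 / 4"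
    using eventually_poly_exp_small[of "\<epsilon>\<^sup>2 / 2" "k - 1"] e by auto
  show ?thesis
  proof (intro exI[of _ "max m0 k"] allI impI)
    fix m n d and G :: "'a hypergraph"
    assume m: "max m0 k \<le> m" and n: "4 * m\<^sup>2 \<le> n" and G: "uniform_hypergraph k G"
      and cG: "card (verts G) = n" and dG: "d \<le> min_codegree k G"
    define V where "V = verts G"
    let ?P = "PiE {..<m} (\<lambda>_. V)"
    let ?t = "(real d / real n - \<epsilon>) * real m"
    have V: "finite V" "card V = n" using G cG by (auto simp: V_def uniform_hypergraph_def)
    have finP: "finite ?P" using V by (intro finite_PiE) auto
    have mk: "k \<le> m" "m \<ge> 1" using m k by auto
    then have n0: "n > 0" using n by (cases n) auto
    define Good where "Good = {f \<in> ?P. inj_on f {..<m} \<and> ?t \<le> min_codegree k (pullback k m G f)}"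
    define Bad where "Bad = {f \<in> ?P. \<not> inj_on f {..<m}}"
    define BadI where "BadI = (\<lambda>I. {f \<in> ?P. inj_on f {..<m} \<and> \<not> ?t \<le> card (nbrs (pullback k m G f) I)})"
    let ?J = "nsets {..<m} (k - 1)"
    have finJ: "finite ?J" by (simp add: finite_imp_finite_nsets)
    have cover: "?P \<subseteq> Good \<union> (Bad \<union> (\<Union>I\<in>?J. BadI I))"
    proof
      fix f assume f: "f \<in> ?P"
      show "f \<in> Good \<union> (Bad \<union> (\<Union>I\<in>?J. BadI I))"
      proof (rule ccontr)
        assume neg: "\<not> ?thesis"
        then have inj: "inj_on f {..<m}" using f by (auto simp: Bad_def)
        have "?t \<le> card (nbrs (pullback k m G f) I)" if "I \<in> ?J" for I
          using neg that f inj by (auto simp: BadI_def)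
        \<comment> \<open>The threshold may be fractional or negative; rounding up and truncating at
          0 makes it a natural number.\<close>
        then have "nat \<lceil>?t\<rceil> \<le> min_codegree k (pullback k m G f)"
          using mk by (intro min_codegree_ge[OF uniform_pullback k]) auto
        then have "?t \<le> min_codegree k (pullback k m G f)" by linarith
        then show False using neg f inj by (auto simp: Good_def)
      qed
    qed
    have BadI: "real (card (BadI I)) \<le> real n ^ m * exp (real (k - 1) - \<epsilon>\<^sup>2 / 2 * real m)"
      if I: "I \<in> ?J" for I
    proof -
      have Im: "I \<subseteq> {..<m}" "card I = k - 1" "finite I" using I by (auto simp: nsets_def)
      define Gs where "Gs = {g \<in> PiE I (\<lambda>_. V). inj_on g I}"
      define C where "C = (\<lambda>g. {f \<in> ?P. restrict f I = g \<and>
            real (card {i \<in> {..<m} - I. f i \<in> nbrs G (g ` I)}) \<le> ?t})"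
      have finPI: "finite (PiE I (\<lambda>_. V))" using V Im by (intro finite_PiE) auto
      have sub: "BadI I \<subseteq> (\<Union>g\<in>Gs. C g)"
      proof
        fix f assume f: "f \<in> BadI I"
        then have fP: "f \<in> ?P" and inj: "inj_on f {..<m}"
          and lt: "\<not> ?t \<le> card (nbrs (pullback k m G f) I)" by (auto simp: BadI_def)
        have im: "restrict f I ` I = f ` I" by auto
        have "restrict f I \<in> Gs" using fP Im inj by (auto simp: Gs_def inj_on_subset)
        moreover have "{i \<in> {..<m} - I. f i \<in> nbrs G (f ` I)} \<subseteq> nbrs (pullback k m G f) I"
          using Im k by (auto simp: nbrs_def pullback_def nsets_def)
        then have "card {i \<in> {..<m} - I. f i \<in> nbrs G (f ` I)} \<le> card (nbrs (pullback k m G f) I)"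
          by (intro card_mono finite_nbrs[OF uniform_pullback])
        then have "f \<in> C (restrict f I)" using lt fP unfolding C_def im by simp
        ultimately show "f \<in> (\<Union>g\<in>Gs. C g)" by blast
      qed
      have Cle: "real (card (C g)) \<le> real n ^ (m - (k - 1)) * exp (real (k - 1) - \<epsilon>\<^sup>2 / 2 * real m)"
        if g: "g \<in> Gs" for g
      proof -
        have gP: "g \<in> PiE I (\<lambda>_. V)" "inj_on g I" using g by (auto simp: Gs_def)
        then have "g ` I \<in> nsets (verts G) (k - 1)"
          using Im by (auto simp: nsets_def card_image V_def)
        then have "d \<le> card (nbrs G (g ` I))" using min_codegree_le[OF G k] dG le_trans by blast
        from card_few_hits_exp[OF V n0 Im(1) gP(1) _ this e] nbrs_subset[OF G]
        show ?thesis unfolding C_def Im(2) V_def by blast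
      qed
      have "real (card (BadI I)) \<le> real (card (\<Union>g\<in>Gs. C g))"
        using finP finPI by (intro of_nat_mono card_mono[OF _ sub]) (auto simp: Gs_def C_def)
      also have "\<dots> \<le> real (\<Sum>g\<in>Gs. card (C g))"
        using finPI by (intro of_nat_mono card_UN_le) (auto simp: Gs_def)
      also have "\<dots> \<le> (\<Sum>g\<in>Gs. real n ^ (m - (k - 1)) * exp (real (k - 1) - \<epsilon>\<^sup>2 / 2 * real m))"
        unfolding of_nat_sum by (rule sum_mono) (rule Cle)
      also have "\<dots> = real (card Gs) * (real n ^ (m - (k - 1)) * exp (real (k - 1) - \<epsilon>\<^sup>2 / 2 * real m))"
        by simp
      also have "\<dots> \<le> real n ^ (k - 1) * (real n ^ (m - (k - 1)) * exp (real (k - 1) - \<epsilon>\<^sup>2 / 2 * real m))"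
      proof (rule mult_right_mono)
        have "card Gs \<le> card (PiE I (\<lambda>_. V))" by (rule card_mono[OF finPI]) (auto simp: Gs_def)
        also have "\<dots> = n ^ (k - 1)" using Im V by (simp add: card_PiE)
        finally show "real (card Gs) \<le> real n ^ (k - 1)" by (simp flip: of_nat_power)
      qed auto
      also have "\<dots> = real n ^ m * exp (real (k - 1) - \<epsilon>\<^sup>2 / 2 * real m)"
        using mk by (simp add: mult.assoc[symmetric] power_add[symmetric])
      finally show ?thesis .
    qed
    have cJ: "real (card ?J) \<le> real m ^ (k - 1)"
      using binomial_le_pow[of "k - 1" m] mk by (simp flip: of_nat_power)
    have "real (card (\<Union>I\<in>?J. BadI I)) \<le> real (\<Sum>I\<in>?J. card (BadI I))"
      by (intro of_nat_mono card_UN_le finJ)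
    also have "\<dots> \<le> (\<Sum>I\<in>?J. real n ^ m * exp (real (k - 1) - \<epsilon>\<^sup>2 / 2 * real m))"
      unfolding of_nat_sum by (rule sum_mono) (rule BadI)
    also have "\<dots> = real (card ?J) * (real n ^ m * exp (real (k - 1) - \<epsilon>\<^sup>2 / 2 * real m))"
      by simp
    also have "\<dots> \<le> real m ^ (k - 1) * (real n ^ m * exp (real (k - 1) - \<epsilon>\<^sup>2 / 2 * real m))"
      by (intro mult_right_mono cJ) auto
    also have "\<dots> = real n ^ m * (real m ^ (k - 1) * exp (real (k - 1) - \<epsilon>\<^sup>2 / 2 * real m))" by simp
    also have "\<dots> \<le> real n ^ m * (1 / 4)"
      using m by (intro mult_left_mono m0) auto
    finally have U: "real (card (\<Union>I\<in>?J. BadI I)) \<le> real n ^ m / 4" by simp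
    have B: "real (card Bad) \<le> real n ^ m / 4"
      unfolding Bad_def by (rule card_not_inj[OF V n])
    have finite: "finite Good" "finite Bad" "finite (\<Union>I\<in>?J. BadI I)"
      using finP finJ by (auto simp: Good_def Bad_def BadI_def)
    have "n ^ m = card ?P" using V by (simp add: card_PiE)
    also have "\<dots> \<le> card (Good \<union> (Bad \<union> (\<Union>I\<in>?J. BadI I)))"
      using finite by (intro card_mono cover) blast
    also have "\<dots> \<le> card Good + (card Bad + card (\<Union>I\<in>?J. BadI I))"
      using card_Un_le[of Good] card_Un_le[of Bad "\<Union>I\<in>?J. BadI I"] by (meson add_left_mono le_trans)
    finally have "real (n ^ m) \<le> real (card Good + (card Bad + card (\<Union>I\<in>?J. BadI I)))"
      by (simp only: of_nat_le_iff)
    then have "real n ^ m / 2 \<le> real (card Good)" using U B by simp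
    then show "real n ^ m / 2 \<le> real (card {f \<in> PiE {..<m} (\<lambda>_. verts G). inj_on f {..<m} \<and>
        ?t \<le> min_codegree k (pullback k m G f)})"
      unfolding Good_def V_def .
  qed
qed

section \<open>Boxes in dense sets of functions\<close>

text \<open>Double counting of pairs of a prefix \<open>x\<close> and a \<open>t\<close>-set
  \<open>T\<close> of admissible last values. At least c n^m / 2 prefixes have c n / 2 or more such
  values, and each of these admits at least (c n / (2 t))^t sets \<open>T\<close>. As there are at
  most n^t sets in total, some \<open>T\<close> serves the average number of prefixes.\<close>

lemma box_step:
  fixes V :: "'a set" and c :: real
  assumes V: "finite V" "card V = n" and c: "0 < c" and t: "t \<ge> 1" and n: "2 * real t \<le> c * real n"
    and R: "R \<subseteq> PiE {..<Suc m} (\<lambda>_. V)" and cR: "c * real n ^ Suc m \<le> real (card R)"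
  shows "\<exists>T \<in> nsets V t. c / 2 * (c / (2 * real t)) ^ t * real n ^ m
           \<le> real (card {x \<in> PiE {..<m} (\<lambda>_. V). \<forall>y\<in>T. x(m := y) \<in> R})"
proof -
  let ?P = "PiE {..<m} (\<lambda>_. V)"
  have finP: "finite ?P" using V by (intro finite_PiE) auto
  have cP: "card ?P = n ^ m" using V by (simp add: card_PiE)
  have finR: "finite R" using R V finite_subset[OF R] by (simp add: finite_PiE)
  have n0: "n > 0" using n t c by (cases n) auto
  define D where "D = (\<lambda>x. {y \<in> V. x(m := y) \<in> R})"
  define X where "X = {x \<in> ?P. c / 2 * real n \<le> real (card (D x))}"
  have finD: "finite (D x)" "card (D x) \<le> n" for x
    using V card_mono[of V "D x"] by (auto simp: D_def)
  have "R \<subseteq> (\<Union>x\<in>?P. (\<lambda>y. x(m := y)) ` D x)"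
  proof
    fix f assume f: "f \<in> R"
    then have fP: "f \<in> PiE {..<Suc m} (\<lambda>_. V)" using R by blast
    have "f = (restrict f {..<m})(m := f m)"
      using fP by (auto simp: fun_eq_iff PiE_iff extensional_def)
    moreover from this have "f m \<in> D (restrict f {..<m})" using f fP by (auto simp: D_def)
    moreover have "restrict f {..<m} \<in> ?P" using fP by (simp add: PiE_iff)
    ultimately show "f \<in> (\<Union>x\<in>?P. (\<lambda>y. x(m := y)) ` D x)" by (intro UN_I image_eqI)
  qed
  then have "card R \<le> card (\<Union>x\<in>?P. (\<lambda>y. x(m := y)) ` D x)"
    using finP finD by (intro card_mono) auto
  also have "\<dots> \<le> (\<Sum>x\<in>?P. card ((\<lambda>y. x(m := y)) ` D x))"
    by (rule card_UN_le[OF finP])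
  also have "\<dots> \<le> (\<Sum>x\<in>?P. card (D x))"
    by (intro sum_mono card_image_le finD)
  finally have "real (card R) \<le> (\<Sum>x\<in>?P. real (card (D x)))"
    by (simp flip: of_nat_sum)
  also have "\<dots> \<le> (\<Sum>x\<in>?P. c / 2 * real n + (if x \<in> X then real n else 0))"
    using c finD by (intro sum_mono) (auto simp: X_def add_increasing)
  also have "\<dots> = c / 2 * real n ^ Suc m + real n * real (card X)"
    using finP by (simp add: sum.distrib cP sum.If_cases X_def Int_def)
  finally have "c / 2 * real n ^ Suc m \<le> real n * real (card X)"
    using cR by simp
  then have cX: "c / 2 * real n ^ m \<le> real (card X)"
    using n0 by simp
  have finX: "finite X" using finP by (simp add: X_def)
  let ?N = "nsets V t"
  have finN: "finite ?N" using V by (simp add: finite_imp_finite_nsets)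
  define h where "h = (\<lambda>T. card {x \<in> X. T \<subseteq> D x})"
  have tn: "t \<le> n"
  proof -
    obtain x where "x \<in> X"
    proof -
      have "0 < c / 2 * real n ^ m" using c n0 by simp
      then have "card X > 0" using cX by linarith
      then show thesis using that by (metis card_gt_0_iff ex_in_conv)
    qed
    then have "c / 2 * real n \<le> real n" using finD(2)[of x] by (auto simp: X_def)
    then have "real t \<le> real n" using n by linarith
    then show ?thesis by simp
  qed
  have "real (card X) * (c / (2 * real t) * real n) ^ t \<le> (\<Sum>x\<in>X. real (card (nsets (D x) t)))"
  proof -
    have "(c / (2 * real t) * real n) ^ t \<le> real (card (nsets (D x) t))" if x: "x \<in> X" for x
    proof -
      have xD: "c / 2 * real n \<le> real (card (D x))" using x by (simp add: X_def)
      then have "real t \<le> real (card (D x))" using n by linarith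
      then have le: "t \<le> card (D x)" by simp
      have "(c / (2 * real t) * real n) ^ t \<le> (real (card (D x)) / real t) ^ t"
        using xD c t by (intro power_mono) (auto simp: field_simps)
      also have "\<dots> \<le> real (card (D x) choose t)"
        by (rule binomial_ge_n_over_k_pow_k[OF le])
      finally show ?thesis by simp
    qed
    then have "(\<Sum>x\<in>X. (c / (2 * real t) * real n) ^ t) \<le> (\<Sum>x\<in>X. real (card (nsets (D x) t)))"
      by (rule sum_mono)
    then show ?thesis by simp
  qed
  also have "(\<Sum>x\<in>X. real (card (nsets (D x) t))) = (\<Sum>T\<in>?N. real (h T))"
  proof -
    have "nsets (D x) t = {T \<in> ?N. T \<subseteq> D x}" for x
      by (auto simp: nsets_def D_def)
    then have "(\<Sum>x\<in>X. card (nsets (D x) t)) = (\<Sum>x\<in>X. card {T \<in> ?N. T \<subseteq> D x})"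
      by metis
    also have "\<dots> = (\<Sum>T\<in>?N. h T)"
      unfolding h_def by (rule sum_multicount_gen[OF finX finN]) simp
    finally show ?thesis by (simp flip: of_nat_sum)
  qed
  finally have total: "real (card X) * (c / (2 * real t) * real n) ^ t \<le> (\<Sum>T\<in>?N. real (h T))" .
  define B where "B = real (card X) * (c / (2 * real t)) ^ t"
  have "\<exists>T\<in>?N. B \<le> real (h T)"
  proof (rule ccontr)
    assume "\<not> ?thesis"
    then have lt: "\<And>T. T \<in> ?N \<Longrightarrow> real (h T) < B" by force
    have ne: "?N \<noteq> {}" using tn V by (simp add: nsets_eq_empty_iff)
    have "(\<Sum>T\<in>?N. real (h T)) < (\<Sum>T\<in>?N. B)"
      by (rule sum_strict_mono[OF finN ne lt])
    also have "\<dots> = real (n choose t) * B" using V by simp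
    also have "\<dots> \<le> real n ^ t * B"
    proof (rule mult_right_mono)
      show "real (n choose t) \<le> real n ^ t" using binomial_le_pow[OF tn] by (simp flip: of_nat_power)
      show "0 \<le> B" using c by (simp add: B_def)
    qed
    also have "\<dots> = real (card X) * (c / (2 * real t) * real n) ^ t"
      by (simp add: B_def power_mult_distrib power_divide)
    finally show False using total by simp
  qed
  then obtain T where T: "T \<in> ?N" "B \<le> real (h T)" by blast
  have "c / 2 * (c / (2 * real t)) ^ t * real n ^ m = c / 2 * real n ^ m * (c / (2 * real t)) ^ t"
    by simp
  also have "\<dots> \<le> B" unfolding B_def using cX c by (intro mult_right_mono) auto
  also have "\<dots> \<le> real (h T)" by (rule T)
  also have "\<dots> \<le> real (card {x \<in> ?P. \<forall>y\<in>T. x(m := y) \<in> R})"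
    unfolding h_def using finP by (intro of_nat_mono card_mono) (auto simp: X_def D_def)
  finally show ?thesis using T(1) by blast
qed

text \<open>This is Erdos's theorem on complete \<open>m\<close>-partite subgraphs of dense \<open>m\<close>-graphs, stated for
  functions.\<close>

lemma dense_contains_box:
  fixes c :: real
  assumes c: "0 < c" and t: "t \<ge> 1"
  shows "\<exists>n0. \<forall>(V :: 'a set) R. finite V \<longrightarrow> n0 \<le> card V \<longrightarrow> R \<subseteq> PiE {..<m} (\<lambda>_. V) \<longrightarrow>
     c * real (card V) ^ m \<le> real (card R) \<longrightarrow> (\<exists>A. (\<forall>i<m. A i \<in> nsets V t) \<and> PiE {..<m} A \<subseteq> R)"
  using c
proof (induction m arbitrary: c)
  case 0
  show ?case
  proof (intro exI[of _ 0] allI impI)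
    fix V :: "'a set" and R assume "R \<subseteq> PiE {..<0::nat} (\<lambda>_. V)" "c * real (card V) ^ 0 \<le> real (card R)"
    then have "R \<noteq> {}" "R \<subseteq> {\<lambda>_. undefined}" using 0 by (force, simp)
    then have "R = {\<lambda>_. undefined}" by blast
    then show "\<exists>A. (\<forall>i<0. A i \<in> nsets V t) \<and> PiE {..<0} A \<subseteq> R" by auto
  qed
next
  case (Suc m)
  \<comment> \<open>This is the density that \<open>box_step\<close> leaves after splitting off the
    last coordinate, so the induction has to allow an arbitrary \<open>c\<close>.\<close>
  define c' where "c' = c / 2 * (c / (2 * real t)) ^ t"
  have "c' > 0" using Suc.prems t by (simp add: c'_def)
  from Suc.IH[OF this] obtain n0 where "\<forall>(V :: 'a set) R. finite V \<longrightarrow> n0 \<le> card V \<longrightarrow>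
     R \<subseteq> PiE {..<m} (\<lambda>_. V) \<longrightarrow> c' * real (card V) ^ m \<le> real (card R) \<longrightarrow>
     (\<exists>A. (\<forall>i<m. A i \<in> nsets V t) \<and> PiE {..<m} A \<subseteq> R)" ..
  note n0 = this[rule_format]
  show ?case
  proof (intro exI[of _ "max n0 (nat \<lceil>2 * real t / c\<rceil>)"] allI impI)
    fix V :: "'a set" and R
    assume V: "finite V" and n: "max n0 (nat \<lceil>2 * real t / c\<rceil>) \<le> card V"
      and R: "R \<subseteq> PiE {..<Suc m} (\<lambda>_. V)" "c * real (card V) ^ Suc m \<le> real (card R)"
    have "2 * real t / c \<le> real (card V)" using n by linarith
    then have "2 * real t \<le> c * real (card V)" using Suc.prems by (simp add: field_simps)
    from box_step[OF V refl Suc.prems t this R] obtain T where T: "T \<in> nsets V t"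
      and le: "c' * real (card V) ^ m \<le> real (card {x \<in> PiE {..<m} (\<lambda>_. V). \<forall>y\<in>T. x(m := y) \<in> R})"
      unfolding c'_def by blast
    from n0[OF V _ _ le] n obtain A where A: "\<forall>i<m. A i \<in> nsets V t"
      and sub: "PiE {..<m} A \<subseteq> {x \<in> PiE {..<m} (\<lambda>_. V). \<forall>y\<in>T. x(m := y) \<in> R}" by auto
    show "\<exists>A. (\<forall>i<Suc m. A i \<in> nsets V t) \<and> PiE {..<Suc m} A \<subseteq> R"
    proof (intro exI[of _ "A(m := T)"] conjI allI impI subsetI)
      show "(A(m := T)) i \<in> nsets V t" if "i < Suc m" for i using that A T by (auto simp: less_Suc_eq)
      fix f assume f: "f \<in> PiE {..<Suc m} (A(m := T))"
      then have fi: "f i \<in> (A(m := T)) i" if "i < Suc m" for i using that by (auto simp: PiE_iff)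
      have "restrict f {..<m} \<in> PiE {..<m} A" using fi by (fastforce simp: PiE_iff less_Suc_eq split: if_splits)
      moreover have "f m \<in> T" using fi[of m] by simp
      ultimately have "(restrict f {..<m})(m := f m) \<in> R" using sub by blast
      moreover have "f = (restrict f {..<m})(m := f m)"
        using f by (auto simp: fun_eq_iff PiE_iff extensional_def)
      ultimately show "f \<in> R" by simp
    qed
  qed
qed

section \<open>Existence and range of the density\<close>

text \<open>Let \<open>L\<close> be the limit of a convergent subsequence. Letting \<open>n\<close>
  run along it in the hypothesis gives a m \<ge> L - \<epsilon> for all large \<open>m\<close>.
  Conversely, one large \<open>m\<close> in the subsequence has a m < L + \<epsilon>, which keeps
  all later terms below L + 2 \<epsilon>.\<close>

lemma convergent_of_almost_decreasing:
  fixes a :: "nat \<Rightarrow> real"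
  assumes bd: "\<And>n. a n \<in> {0..1}"
    and dec: "\<And>\<epsilon>. 0 < \<epsilon> \<Longrightarrow> \<epsilon> \<le> 1 \<Longrightarrow> \<exists>m0. \<forall>m\<ge>m0. \<exists>n0. \<forall>n\<ge>n0. a n - \<epsilon> \<le> a m"
  shows "convergent a"
proof -
  obtain L \<sigma> where s: "strict_mono \<sigma>" "(a \<circ> \<sigma>) \<longlonglongrightarrow> L"
    by (rule seq_compactE[OF compact_imp_seq_compact[OF compact_Icc[of "0::real" 1]], of a]) (use bd in auto)
  have "a \<longlonglongrightarrow> L"
  proof (rule LIMSEQ_I)
    fix r :: real assume r: "r > 0"
    define \<epsilon> where "\<epsilon> = min 1 (r / 2)"
    have e: "0 < \<epsilon>" "\<epsilon> \<le> 1" "2 * \<epsilon> \<le> r" using r by (auto simp: \<epsilon>_def)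
    obtain m0 where m0: "\<And>m. m0 \<le> m \<Longrightarrow> \<exists>n0. \<forall>n\<ge>n0. a n - \<epsilon> \<le> a m" using dec[OF e(1,2)] by blast
    have lower: "L - \<epsilon> \<le> a m" if m: "m0 \<le> m" for m
    proof -
      obtain n0 where n0: "\<And>n. n0 \<le> n \<Longrightarrow> a n - \<epsilon> \<le> a m" using m0[OF m] by blast
      have "L \<le> a m + \<epsilon>"
      proof (rule LIMSEQ_le_const2[OF s(2)], intro exI[of _ n0] allI impI)
        fix j assume "n0 \<le> j"
        then have "n0 \<le> \<sigma> j" using seq_suble[OF s(1), of j] by simp
        then show "(a \<circ> \<sigma>) j \<le> a m + \<epsilon>" using n0[of "\<sigma> j"] by simp
      qed
      then show ?thesis by simp
    qed
    obtain j0 where j0: "\<And>j. j0 \<le> j \<Longrightarrow> norm ((a \<circ> \<sigma>) j - L) < \<epsilon>" using LIMSEQ_D[OF s(2) e(1)] by blast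
    define m where "m = \<sigma> (max j0 m0)"
    have am: "a m < L + \<epsilon>" using j0[of "max j0 m0"] by (simp add: m_def abs_less_iff)
    have "m0 \<le> m" using seq_suble[OF s(1), of "max j0 m0"] by (simp add: m_def)
    then obtain n0 where n0: "\<And>n. n0 \<le> n \<Longrightarrow> a n - \<epsilon> \<le> a m" using m0 by blast
    show "\<exists>no. \<forall>n\<ge>no. norm (a n - L) < r"
    proof (intro exI[of _ "max m0 n0"] allI impI)
      fix n assume "max m0 n0 \<le> n"
      then show "norm (a n - L) < r" using lower[of n] n0[of n] am e by (simp add: abs_less_iff)
    qed
  qed
  then show ?thesis by (rule convergentI)
qed

text \<open>Injective samples of an \<open>F\<close>-free host are \<open>F\<close>-free, and some
  sample of size \<open>m\<close> loses at most \<epsilon> in relative codegree. Hence the ratios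
  are almost decreasing, and \<open>lim\<close> in the definition denotes a genuine limit.\<close>

lemma codegree_density_limit:
  assumes k: "k \<ge> 1"
  shows "(\<lambda>n. real (ex_co k n F) / real n) \<longlonglongrightarrow> codegree_density k F"
proof -
  have "convergent (\<lambda>n. real (ex_co k n F) / real n)"
  proof (rule convergent_of_almost_decreasing)
    show "real (ex_co k n F) / real n \<in> {0..1}" for n
      using ex_co_le[OF k, of n F] by (auto simp: divide_le_eq_1)
    fix \<epsilon> :: real assume e: "0 < \<epsilon>" "\<epsilon> \<le> 1"
    obtain m0 where m0: "\<forall>m n d (G :: nat hypergraph). m0 \<le> m \<longrightarrow> 4 * m\<^sup>2 \<le> n \<longrightarrow> uniform_hypergraph k G \<longrightarrow>
     card (verts G) = n \<longrightarrow> d \<le> min_codegree k G \<longrightarrow>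
     real n ^ m / 2 \<le> real (card {f \<in> PiE {..<m} (\<lambda>_. verts G). inj_on f {..<m} \<and>
        (real d / real n - \<epsilon>) * real m \<le> min_codegree k (pullback k m G f)})"
      using sampling[OF k e] ..
    show "\<exists>m0. \<forall>m\<ge>m0. \<exists>n0. \<forall>n\<ge>n0. real (ex_co k n F) / real n - \<epsilon> \<le> real (ex_co k m F) / real m"
    proof (rule exI[of _ "max m0 1"], intro allI impI, rule exI, intro allI impI)
      fix m n assume m: "max m0 1 \<le> m" and n: "4 * m\<^sup>2 \<le> n"
      show "real (ex_co k n F) / real n - \<epsilon> \<le> real (ex_co k m F) / real m"
      \<comment> \<open>A host is available only for a positive value; for the value 0 the left side
        is -\<epsilon>.\<close>
      proof (cases "ex_co k n F = 0")
        case True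
        then show ?thesis using e by (auto intro: order_trans[of _ 0])
      next
        case False
        then obtain G :: "nat hypergraph" where G: "uniform_hypergraph k G" "card (verts G) = n"
          "\<not> contains_copy G F" "ex_co k n F \<le> min_codegree k G"
          using ex_co_witness[OF k] by blast
        define Good where "Good = {f \<in> PiE {..<m} (\<lambda>_. verts G). inj_on f {..<m} \<and>
            (real (ex_co k n F) / real n - \<epsilon>) * real m \<le> min_codegree k (pullback k m G f)}"
        have "real n ^ m / 2 \<le> real (card Good)"
          using m0[rule_format, OF _ n G(1,2,4)] m unfolding Good_def by simp
        moreover have "0 < real n ^ m / 2" using m n by (cases n) auto
        ultimately have "card Good > 0" by linarith
        then obtain f where f: "f \<in> Good" by (metis card_gt_0_iff ex_in_conv)
        have "\<not> contains_copy (pullback k m G f) F"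
          using contains_copy_pullback[of f m G k F] f G(3) by (auto simp: Good_def)
        then have "min_codegree k (pullback k m G f) \<le> ex_co k m F"
          by (intro ex_co_ge[OF uniform_pullback k]) auto
        then have "(real (ex_co k n F) / real n - \<epsilon>) * real m \<le> real (ex_co k m F)"
          using f unfolding Good_def by auto
        then show ?thesis using m by (simp add: field_simps)
      qed
    qed
  qed
  then show ?thesis unfolding codegree_density_def by (simp only: convergent_LIMSEQ_iff)
qed

lemma codegree_density_nonneg: "k \<ge> 1 \<Longrightarrow> 0 \<le> codegree_density k F"
  by (rule LIMSEQ_le_const[OF codegree_density_limit]) simp_all

text \<open>Greedy extension: a clique on fewer than \<open>f\<close> vertices has at most 2^f
  subsets of size \<open>k - 1\<close>, each of which rules out at most \<open>n - d\<close>
  vertices, so some new vertex is joined to all of them.\<close>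

lemma clique_of_large_codegree:
  assumes G: "uniform_hypergraph k G" and k: "k \<ge> 1" and n: "card (verts G) = n"
    and d: "d \<le> min_codegree k G" and big: "f + 2 ^ f * (n - d) < n" and j: "j \<le> f"
  shows "\<exists>K. K \<subseteq> verts G \<and> card K = j \<and> nsets K k \<subseteq> edges G"
  using j
proof (induction j)
  case 0
  show ?case using k by (intro exI[of _ "{}"]) (simp add: nsets_empty_iff)
next
  case (Suc j)
  then obtain K where K: "K \<subseteq> verts G" "card K = j" "nsets K k \<subseteq> edges G" by auto
  have V: "finite (verts G)" using G by (simp add: uniform_hypergraph_def)
  then have fK: "finite K" using K finite_subset by blast
  define Bad where "Bad = K \<union> (\<Union>S\<in>nsets K (k - 1). verts G - nbrs G S)"
  have "card Bad \<le> card K + card (\<Union>S\<in>nsets K (k - 1). verts G - nbrs G S)"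
    unfolding Bad_def by (rule card_Un_le)
  also have "card (\<Union>S\<in>nsets K (k - 1). verts G - nbrs G S) \<le> (\<Sum>S\<in>nsets K (k - 1). card (verts G - nbrs G S))"
    by (intro card_UN_le finite_imp_finite_nsets fK)
  also have "\<dots> \<le> (\<Sum>S\<in>nsets K (k - 1). n - d)"
  proof (rule sum_mono)
    fix S assume "S \<in> nsets K (k - 1)"
    then have "S \<in> nsets (verts G) (k - 1)" using K nsets_mono by blast
    then have "d \<le> card (nbrs G S)" using min_codegree_le[OF G k] d le_trans by blast
    then show "card (verts G - nbrs G S) \<le> n - d"
      using nbrs_subset[OF G] finite_nbrs[OF G] n by (simp add: card_Diff_subset)
  qed
  also have "\<dots> \<le> 2 ^ f * (n - d)"
  proof -
    have "j choose (k - 1) \<le> 2 ^ j" by (rule binomial_le_pow2)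
    also have "\<dots> \<le> 2 ^ f" using Suc.prems by (intro power_increasing) auto
    finally show ?thesis using K by (simp add: mult_right_mono)
  qed
  finally have "card Bad < card (verts G)" using K Suc.prems big n by simp
  moreover have "finite Bad" unfolding Bad_def using V fK by (simp add: finite_imp_finite_nsets)
  ultimately have "\<not> verts G \<subseteq> Bad" using card_mono[of Bad "verts G"] by linarith
  then obtain v where v: "v \<in> verts G" "v \<notin> Bad" by blast
  show ?case
  proof (intro exI[of _ "insert v K"] conjI subsetI)
    show "card (insert v K) = Suc j" using v fK K by (simp add: Bad_def)
    fix e assume e: "e \<in> nsets (insert v K) k"
    show "e \<in> edges G"
    proof (cases "v \<in> e")
      case True
      then have "e - {v} \<in> nsets K (k - 1)" using e by (auto simp: nsets_def)
      then have "v \<in> nbrs G (e - {v})" using v unfolding Bad_def by blast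
      then show ?thesis using True by (simp add: nbrs_def insert_absorb)
    next
      case False
      then have "e \<in> nsets K k" using e by (auto simp: nsets_def)
      then show ?thesis using K by blast
    qed
  qed (use v K in auto)
qed

lemma codegree_density_less_1:
  assumes k: "k \<ge> 1" and F: "uniform_hypergraph k F"
  shows "codegree_density k F < 1"
proof -
  define f where "f = card (verts F)"
  \<comment> \<open>The factor 2 keeps 2^f (n - d) below n / 2, and n \<ge> 2 f + 1 keeps
    \<open>f\<close> below n / 2, as the greedy clique requires.\<close>
  define \<delta> :: real where "\<delta> = 1 / (2 * 2 ^ f)"
  have finF: "finite (verts F)" using F by (simp add: uniform_hypergraph_def)
  have "real (ex_co k n F) / real n \<le> 1 - \<delta>" if n: "2 * f + 1 \<le> n" for n
  proof (rule ccontr)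
    assume "\<not> ?thesis"
    then have gt: "(1 - \<delta>) * real n < real (ex_co k n F)" using n by (simp add: field_simps)
    have "(1 :: real) \<le> 2 * 2 ^ f" using one_le_power[of "2 :: real" f] by linarith
    then have "0 \<le> 1 - \<delta>" by (simp add: \<delta>_def)
    then have "0 \<le> (1 - \<delta>) * real n" by simp
    then have "ex_co k n F > 0" using gt by linarith
    then obtain G :: "nat hypergraph" where G: "uniform_hypergraph k G" "card (verts G) = n"
          "\<not> contains_copy G F" "ex_co k n F \<le> min_codegree k G"
      using ex_co_witness[OF k] by blast
    define d where "d = ex_co k n F"
    have "d \<le> n" using ex_co_le[OF k] by (simp add: d_def)
    have "real (n - d) < \<delta> * real n" using gt \<open>d \<le> n\<close> by (simp add: d_def of_nat_diff algebra_simps)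
    then have "2 * 2 ^ f * real (n - d) < real n" by (simp add: \<delta>_def field_simps)
    then have "real (2 * 2 ^ f * (n - d)) < real n" by simp
    then have "2 * 2 ^ f * (n - d) < n" by (simp only: of_nat_less_iff)
    then have "f + 2 ^ f * (n - d) < n" using n by linarith
    from clique_of_large_codegree[OF G(1) k G(2,4)[folded d_def] this order_refl]
    obtain K where K: "K \<subseteq> verts G" "card K = f" "nsets K k \<subseteq> edges G" by blast
    have "finite K" using K G(1) finite_subset by (auto simp: uniform_hypergraph_def)
    then obtain p where p: "bij_betw p (verts F) K"
      using finite_same_card_bij[OF finF] K f_def by metis
    have "contains_copy G F" unfolding contains_copy_def
    proof (intro exI conjI ballI)
      show "inj_on p (verts F)" "p ` verts F \<subseteq> verts G" using p K by (auto simp: bij_betw_def)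
      fix e assume e: "e \<in> edges F"
      have "p ` e \<in> nsets K k"
        using uniform_edgeD[OF F e] p by (auto simp: nsets_def bij_betw_def card_image inj_on_subset)
      then show "p ` e \<in> edges G" using K by blast
    qed
    then show False using G by blast
  qed
  then have "codegree_density k F \<le> 1 - \<delta>"
    by (intro LIMSEQ_le_const2[OF codegree_density_limit[OF k]]) blast
  also have "\<dots> < 1" by (simp add: \<delta>_def)
  finally show ?thesis .
qed

section \<open>Upper bounds from homomorphisms\<close>

lemma finite_uniform_hypergraphs:
  assumes "finite V"
  shows "finite {H :: 'a hypergraph. uniform_hypergraph k H \<and> verts H = V}"
proof (rule finite_subset)
  show "{H :: 'a hypergraph. uniform_hypergraph k H \<and> verts H = V}
      \<subseteq> (\<lambda>E. \<lparr>verts = V, edges = E\<rparr>) ` Pow (nsets V k)"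
  proof
    fix H :: "'a hypergraph" assume "H \<in> {H. uniform_hypergraph k H \<and> verts H = V}"
    then have "H = \<lparr>verts = V, edges = edges H\<rparr>" "edges H \<in> Pow (nsets V k)"
      by (auto simp: uniform_hypergraph_def)
    then show "H \<in> (\<lambda>E. \<lparr>verts = V, edges = E\<rparr>) ` Pow (nsets V k)" by blast
  qed
  show "finite ((\<lambda>E. \<lparr>verts = V, edges = E\<rparr>) ` Pow (nsets V k))"
    using assms by (simp add: finite_imp_finite_nsets)
qed

text \<open>Unlike a copy, a homomorphism may identify vertices. Between \<open>k\<close>-uniform
  hypergraphs it is still injective on each edge, by cardinality.\<close>

definition hypergraph_hom :: "'b hypergraph \<Rightarrow> 'a hypergraph \<Rightarrow> ('b \<Rightarrow> 'a) \<Rightarrow> bool" where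
  "hypergraph_hom F H h \<longleftrightarrow> h ` verts F \<subseteq> verts H \<and> (\<forall>e\<in>edges F. h ` e \<in> edges H)"

text \<open>The sets \<open>A i\<close> span a blow-up of \<open>H\<close>, with room for all of
  \<open>F\<close> in each part. Placing every vertex \<open>v\<close> of \<open>F\<close> in the
  part \<open>A (h v)\<close>, injectively within each part, gives a copy.\<close>

lemma contains_copy_of_box:
  fixes G :: "'a hypergraph" and F :: "'b hypergraph"
  assumes F: "uniform_hypergraph k F" and H: "uniform_hypergraph k H" and vH: "verts H = {..<m}"
    and h: "hypergraph_hom F H h" and A: "\<forall>i<m. A i \<in> nsets (verts G) t" and t: "card (verts F) \<le> t" "t \<ge> 1"
    and R: "\<And>f. f \<in> PiE {..<m} A \<Longrightarrow> inj_on f {..<m} \<and> pullback k m G f = H"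
  shows "contains_copy G F"
proof -
  have finF: "finite (verts F)" using F by (simp add: uniform_hypergraph_def)
  have Ai: "finite (A i)" "card (A i) = t" "A i \<subseteq> verts G" if "i < m" for i
    using A that by (auto simp: nsets_def)
  have Ane: "\<exists>y. y \<in> A i" if "i < m" for i
    using Ai[OF that] t by (metis card.empty ex_in_conv not_one_le_zero)
  then obtain a where a: "\<And>i. i < m \<Longrightarrow> a i \<in> A i" by metis
  \<comment> \<open>A point shared by two parts would yield a function in the box that is not
    injective.\<close>
  have disj: "i = j" if "i < m" "j < m" "y \<in> A i" "y \<in> A j" for i j y
  proof -
    define f where "f = restrict (a(i := y, j := y)) {..<m}"
    have "f \<in> PiE {..<m} A" using a that by (auto simp: f_def)
    then have "inj_on f {..<m}" using R by blast
    moreover have "f i = f j" using that by (simp add: f_def)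
    ultimately show "i = j" using that by (auto simp: inj_on_def)
  qed
  have "\<exists>q. inj_on q (verts F) \<and> q ` verts F \<subseteq> A i" if "i < m" for i
    using inj_on_iff_card_le[OF finF Ai(1)[OF that]] Ai(2)[OF that] t by simp
  then obtain q where q: "\<And>i. i < m \<Longrightarrow> inj_on (q i) (verts F) \<and> q i ` verts F \<subseteq> A i" by metis
  define p where "p = (\<lambda>v. q (h v) v)"
  have hm: "h v < m" if "v \<in> verts F" for v using h that vH by (auto simp: hypergraph_hom_def)
  have pA: "p v \<in> A (h v)" if "v \<in> verts F" for v using q[OF hm[OF that]] that by (auto simp: p_def)
  show ?thesis unfolding contains_copy_def
  proof (intro exI conjI ballI)
    show "inj_on p (verts F)"
    proof (rule inj_onI)
      fix v w assume vw: "v \<in> verts F" "w \<in> verts F" "p v = p w"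
      then have "h v = h w" using disj[OF hm hm, of v w "p v"] pA[of v] pA[of w] by simp
      then show "v = w" using vw q[OF hm[OF vw(1)]] by (auto simp: p_def inj_on_def)
    qed
    show "p ` verts F \<subseteq> verts G" using pA Ai(3) hm by blast
    fix e assume e: "e \<in> edges F"
    have he: "h ` e \<in> edges H" using h e by (simp add: hypergraph_hom_def)
    have "card (h ` e) = card e" using uniform_edgeD(3)[OF H he] uniform_edgeD(3)[OF F e] by simp
    then have inj: "inj_on h e" using uniform_edgeD(2)[OF F e] by (simp add: eq_card_imp_inj_on)
    have eV: "e \<subseteq> verts F" using uniform_edgeD[OF F e] by simp
    \<comment> \<open>This sample from the box passes through the image of \<open>e\<close>; its
      pullback is \<open>H\<close>, so \<open>h\<close>
      e\<open>being an edge of\<close>H\<open>makes\<close>p \<open>e\<close> an edge of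
      \<open>G\<close>.\<close>
    define f where "f = (\<lambda>i\<in>{..<m}. if i \<in> h ` e then p (inv_into e h i) else a i)"
    have fh: "f (h v) = p v" if "v \<in> e" for v
      using that inj hm eV by (auto simp: f_def)
    have "f i \<in> A i" if "i < m" for i
    proof (cases "i \<in> h ` e")
      case True
      then obtain v where "v \<in> e" "i = h v" by blast
      then show ?thesis using fh pA eV by auto
    qed (use a that in \<open>simp add: f_def\<close>)
    then have "f \<in> PiE {..<m} A" by (auto simp: f_def)
    then have "h ` e \<in> edges (pullback k m G f)" using R he by simp
    then have "f ` h ` e \<in> edges G" by (simp add: pullback_def)
    moreover have "f ` h ` e = p ` e" using fh by (force simp: image_iff)
    ultimately show "p ` e \<in> edges G" by simp
  qed
qed

text \<open>Homomorphisms suffice for an upper bound on the density: a large \<open>G\<close> has many samples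
  isomorphic to one and the same \<open>H\<close>, and a box of such samples is a blow-up of \<open>H\<close>.\<close>

lemma codegree_density_le_of_hom:
  fixes \<epsilon> :: real
  assumes k: "k \<ge> 1" and e: "0 < \<epsilon>" "\<epsilon> \<le> 1"
  shows "\<exists>m0. \<forall>m\<ge>m0. \<forall>\<alpha>\<ge>0. \<forall>F :: 'b hypergraph. uniform_hypergraph k F \<longrightarrow>
    (\<forall>H. uniform_hypergraph k H \<longrightarrow> verts H = {..<m} \<longrightarrow> \<alpha> * real m \<le> min_codegree k H \<longrightarrow>
       (\<exists>h. hypergraph_hom F H h)) \<longrightarrow>
    codegree_density k F \<le> \<alpha> + \<epsilon>"
proof -
  obtain m0 where m0: "\<forall>m n d (G :: nat hypergraph). m0 \<le> m \<longrightarrow> 4 * m\<^sup>2 \<le> n \<longrightarrow> uniform_hypergraph k G \<longrightarrow>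
     card (verts G) = n \<longrightarrow> d \<le> min_codegree k G \<longrightarrow>
     real n ^ m / 2 \<le> real (card {f \<in> PiE {..<m} (\<lambda>_. verts G). inj_on f {..<m} \<and>
        (real d / real n - \<epsilon>) * real m \<le> min_codegree k (pullback k m G f)})"
    using sampling[OF k e] ..
  show ?thesis
  proof (intro exI[of _ m0] allI impI)
    fix m and \<alpha> :: real and F :: "'b hypergraph"
    assume m: "m0 \<le> m" and \<alpha>: "0 \<le> \<alpha>" and F: "uniform_hypergraph k F"
      and hom: "\<forall>H. uniform_hypergraph k H \<longrightarrow> verts H = {..<m} \<longrightarrow> \<alpha> * real m \<le> min_codegree k H \<longrightarrow>
       (\<exists>h. hypergraph_hom F H h)"
    define HH where "HH = {H :: nat hypergraph. uniform_hypergraph k H \<and> verts H = {..<m}}"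
    have finHH: "finite HH" unfolding HH_def by (rule finite_uniform_hypergraphs) simp
    define t where "t = max 1 (card (verts F))"
    have t: "t \<ge> 1" "card (verts F) \<le> t" by (auto simp: t_def)
    \<comment> \<open>At least half of all functions are good samples, and they fall into at most
      \<open>card HH\<close> patterns. The added 1 makes the pigeonhole inequality strict.\<close>
    define c :: real where "c = 1 / (2 * (real (card HH) + 1))"
    have c: "c > 0" by (simp add: c_def)
    obtain n0 where n0: "\<forall>(V :: nat set) R. finite V \<longrightarrow> n0 \<le> card V \<longrightarrow> R \<subseteq> PiE {..<m} (\<lambda>_. V) \<longrightarrow>
      c * real (card V) ^ m \<le> real (card R) \<longrightarrow> (\<exists>A. (\<forall>i<m. A i \<in> nsets V t) \<and> PiE {..<m} A \<subseteq> R)"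
      using dense_contains_box[OF c t(1)] ..
    have "real (ex_co k n F) / real n \<le> \<alpha> + \<epsilon>" if n: "max (max n0 (4 * m\<^sup>2)) 1 \<le> n" for n
    proof (rule ccontr)
      assume neg: "\<not> ?thesis"
      have "ex_co k n F \<noteq> 0"
      proof
        assume "ex_co k n F = 0"
        then show False using neg \<alpha> e by simp
      qed
      then obtain G :: "nat hypergraph" where G: "uniform_hypergraph k G" "card (verts G) = n"
          "\<not> contains_copy G F" "ex_co k n F \<le> min_codegree k G"
        using ex_co_witness[OF k] by blast
      have V: "finite (verts G)" using G(1) by (simp add: uniform_hypergraph_def)
      define Good where "Good = {f \<in> PiE {..<m} (\<lambda>_. verts G). inj_on f {..<m} \<and>
            (real (ex_co k n F) / real n - \<epsilon>) * real m \<le> min_codegree k (pullback k m G f)}"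
      define R where "R = (\<lambda>H. {f \<in> Good. pullback k m G f = H})"
      have "finite (PiE {..<m} (\<lambda>_. verts G))" using V by (simp add: finite_PiE)
      then have finGood: "finite Good" by (simp add: Good_def)
      have cGood: "real n ^ m / 2 \<le> real (card Good)"
        using m0[rule_format, OF m _ G(1,2,4)] n unfolding Good_def by simp
      have "\<exists>H\<in>HH. c * real n ^ m \<le> real (card (R H))"
      proof (rule ccontr)
        assume "\<not> ?thesis"
        then have small: "real (card (R H)) \<le> c * real n ^ m" if "H \<in> HH" for H using that by force
        have "Good \<subseteq> (\<Union>H\<in>HH. R H)" by (auto simp: R_def HH_def uniform_pullback)
        then have "card Good \<le> card (\<Union>H\<in>HH. R H)"
          using finHH finGood by (intro card_mono) (auto simp: R_def)
        also have "\<dots> \<le> (\<Sum>H\<in>HH. card (R H))" by (rule card_UN_le[OF finHH])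
        finally have "real (card Good) \<le> (\<Sum>H\<in>HH. real (card (R H)))" by (simp flip: of_nat_sum)
        also have "\<dots> \<le> (\<Sum>H\<in>HH. c * real n ^ m)" by (rule sum_mono) (rule small)
        also have "\<dots> = (real (card HH) * c) * real n ^ m" by simp
        also have "\<dots> < (1 / 2) * real n ^ m"
          using n by (intro mult_strict_right_mono) (auto simp: c_def field_simps)
        finally show False using cGood by simp
      qed
      then obtain H where H: "H \<in> HH" "c * real n ^ m \<le> real (card (R H))" by blast
      \<comment> \<open>A single sample with pattern \<open>H\<close> suffices to transfer the
        codegree bound to \<open>H\<close>.\<close>
      have "0 < c * real n ^ m" using c n by simp
      then have "card (R H) > 0" using H by linarith
      then obtain f where f: "f \<in> R H" by (metis card_gt_0_iff ex_in_conv)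
      have HU: "uniform_hypergraph k H" "verts H = {..<m}" using H by (auto simp: HH_def)
      have "\<alpha> * real m \<le> (real (ex_co k n F) / real n - \<epsilon>) * real m"
        using neg by (intro mult_right_mono) auto
      also have "\<dots> \<le> min_codegree k H" using f by (auto simp: R_def Good_def)
      finally obtain h where h: "hypergraph_hom F H h" using hom HU by blast
      have "R H \<subseteq> PiE {..<m} (\<lambda>_. verts G)" by (auto simp: R_def Good_def)
      from n0[rule_format, OF V _ this] n H(2) G(2)
      obtain A where A: "\<forall>i<m. A i \<in> nsets (verts G) t" "PiE {..<m} A \<subseteq> R H" by auto
      have "contains_copy G F"
        by (rule contains_copy_of_box[OF F HU h A(1) t(2,1)]) (use A(2) in \<open>auto simp: R_def Good_def\<close>)
      then show False using G by blast
    qed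
    then show "codegree_density k F \<le> \<alpha> + \<epsilon>"
      by (intro LIMSEQ_le_const2[OF codegree_density_limit[OF k]]) blast
  qed
qed

section \<open>Products and monochromatic closed walks\<close>

text \<open>Among the first |X| + 1 iterates of a successor function two coincide; the walk starts
  at the earlier one.\<close>

lemma closed_walk_of_successors:
  assumes X: "finite X" "X \<noteq> {}" and succ: "\<And>x. x \<in> X \<Longrightarrow> \<exists>y\<in>X. E x y"
  shows "\<exists>w l. 1 \<le> l \<and> l \<le> card X \<and> (\<forall>i. w i \<in> X \<and> E (w i) (w (Suc i))) \<and> w l = w (0 :: nat)"
proof -
  obtain g where g: "\<And>x. x \<in> X \<Longrightarrow> g x \<in> X \<and> E x (g x)" using succ by metis
  obtain x where x: "x \<in> X" using X by blast
  define u where "u = (\<lambda>i. (g ^^ i) x)"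
  have uX: "u i \<in> X" for i by (induction i) (use x g in \<open>auto simp: u_def\<close>)
  have uE: "E (u i) (u (Suc i))" for i using g[OF uX[of i]] by (simp add: u_def)
  have "\<not> inj_on u {..card X}"
  proof
    assume "inj_on u {..card X}"
    from card_inj_on_le[OF this _ X(1)] uX show False by auto
  qed
  then obtain i j where ij: "i < j" "j \<le> card X" "u i = u j"
    unfolding inj_on_def by (metis atMost_iff linorder_neqE_nat)
  show ?thesis
  proof (intro exI conjI allI)
    show "1 \<le> j - i" "j - i \<le> card X" using ij by auto
    show "u (i + n) \<in> X" "E (u (i + n)) (u (i + Suc n))" for n using uX uE[of "i + n"] by auto
    show "u (i + (j - i)) = u (i + 0)" using ij by simp
  qed
qed

lemma monochromatic_nset:
  assumes c: "\<And>v. v \<in> B \<Longrightarrow> c v < (r :: nat)" and B: "r * q < card B"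
  shows "\<exists>i<r. \<exists>T \<in> nsets B (Suc q). \<forall>v\<in>T. c v = i"
proof -
  have finB: "finite B" using B by (metis card.infinite not_less_zero)
  have "\<exists>i<r. Suc q \<le> card {v \<in> B. c v = i}"
  proof (rule ccontr)
    assume "\<not> ?thesis"
    then have small: "card {v \<in> B. c v = i} \<le> q" if "i < r" for i using that by force
    have "B \<subseteq> (\<Union>i<r. {v \<in> B. c v = i})" using c by auto
    then have "card B \<le> card (\<Union>i<r. {v \<in> B. c v = i})" using finB by (intro card_mono) auto
    also have "\<dots> \<le> (\<Sum>i<r. card {v \<in> B. c v = i})" by (rule card_UN_le) simp
    also have "\<dots> \<le> (\<Sum>i<r. q)" by (rule sum_mono) (use small in auto)
    finally show False using B by simp
  qed
  then obtain i where i: "i < r" "Suc q \<le> card {v \<in> B. c v = i}" by blast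
  obtain T where "T \<subseteq> {v \<in> B. c v = i}" "card T = Suc q" "finite T"
    by (rule obtain_subset_with_card_n[OF i(2)])
  then show ?thesis using i by (intro exI[of _ i] conjI bexI[of _ T]) (auto simp: nsets_def)
qed

text \<open>If every colour class had a dead end, the \<open>r\<close> dead ends would have a common neighbourhood,
  and a monochromatic set in it would continue one of them.\<close>

lemma monochromatic_closed_walk:
  assumes k: "k \<ge> 2" and fin: "finite \<S>" and ne: "\<S> \<noteq> {}"
    and common: "\<And>S. (\<And>i. i < r \<Longrightarrow> S i \<in> \<S>) \<Longrightarrow>
      \<exists>B. r * (k - 2) < card B \<and> nsets B (k - 1) \<subseteq> \<S> \<and> (\<forall>i<r. B \<subseteq> nbrs F (S i))"
    and c: "\<And>v. c v < r"
  shows "\<exists>w l i. 1 \<le> l \<and> l \<le> card \<S> \<and>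
     (\<forall>j. w j \<in> \<S> \<and> (\<forall>v\<in>w j. c v = i) \<and> w (Suc j) \<subseteq> nbrs F (w j)) \<and> w l = w (0 :: nat)"
proof -
  define X where "X = (\<lambda>i. {S \<in> \<S>. \<forall>v\<in>S. c v = i})"
  have "\<exists>i<r. X i \<noteq> {} \<and> (\<forall>S\<in>X i. \<exists>S'\<in>X i. S' \<subseteq> nbrs F S)"
  proof (rule ccontr)
    assume neg: "\<not> ?thesis"
    \<comment> \<open>\<open>T\<close> is a dead end of class \<open>i\<close>; if the class is
      empty, any member of \<open>\<S>\<close> serves.\<close>
    have "\<exists>T\<in>\<S>. X i \<noteq> {} \<longrightarrow> (\<forall>S'\<in>X i. \<not> S' \<subseteq> nbrs F T)" if "i < r" for i
    proof (cases "X i = {}")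
      case False
      then have "\<exists>S\<in>X i. \<forall>S'\<in>X i. \<not> S' \<subseteq> nbrs F S" using neg that by blast
      moreover have "X i \<subseteq> \<S>" by (auto simp: X_def)
      ultimately show ?thesis by blast
    qed (use ne in auto)
    then obtain T where T: "\<And>i. i < r \<Longrightarrow> T i \<in> \<S>"
      "\<And>i S'. i < r \<Longrightarrow> S' \<in> X i \<Longrightarrow> \<not> S' \<subseteq> nbrs F (T i)"
      by (metis empty_iff)
    obtain B where B: "r * (k - 2) < card B" "nsets B (k - 1) \<subseteq> \<S>" "\<And>i. i < r \<Longrightarrow> B \<subseteq> nbrs F (T i)"
      using common[of T] T(1) by blast
    \<comment> \<open>More than r (k - 2) vertices in \<open>r\<close> colours contain k - 1 of one
      colour.\<close>
    obtain i S' where S': "i < r" "S' \<in> nsets B (Suc (k - 2))" "\<forall>v\<in>S'. c v = i"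
      using monochromatic_nset[of B c r, OF c B(1)] by blast
    have k1: "Suc (k - 2) = k - 1" using k by simp
    have "S' \<in> X i" using S' B(2) unfolding X_def k1 by blast
    moreover have "S' \<subseteq> nbrs F (T i)" using S' B(3) by (auto simp: nsets_def)
    ultimately show False using T(2) S'(1) by blast
  qed
  then obtain i where i: "i < r" "X i \<noteq> {}" and succ: "\<And>S. S \<in> X i \<Longrightarrow> \<exists>S'\<in>X i. S' \<subseteq> nbrs F S" by blast
  have XS: "X i \<subseteq> \<S>" by (auto simp: X_def)
  then have "finite (X i)" "card (X i) \<le> card \<S>" using fin finite_subset card_mono by blast+
  moreover obtain w l where w: "1 \<le> l" "l \<le> card (X i)"
    "\<forall>j. w j \<in> X i \<and> w (Suc j) \<subseteq> nbrs F (w j)" "w l = w (0 :: nat)"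
    using closed_walk_of_successors[OF \<open>finite (X i)\<close> i(2), of "\<lambda>S S'. S' \<subseteq> nbrs F S"] succ by blast
  ultimately show ?thesis
    by (intro exI[of _ w] exI[of _ l] exI[of _ i]) (auto simp: X_def)
qed

text \<open>Vertices are tuples with one coordinate per factor, the family serving as its own index
  set.\<close>

definition hypergraph_product :: "nat \<Rightarrow> 'a hypergraph set \<Rightarrow> ('a hypergraph \<Rightarrow> 'a) hypergraph" where
  "hypergraph_product k \<H> =
     \<lparr>verts = PiE \<H> verts, edges = {e \<in> nsets (PiE \<H> verts) k. \<forall>H\<in>\<H>. (\<lambda>x. x H) ` e \<in> edges H}\<rparr>"

lemma uniform_hypergraph_product:
  assumes "finite \<H>" "\<And>H. H \<in> \<H> \<Longrightarrow> uniform_hypergraph k H"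
  shows "uniform_hypergraph k (hypergraph_product k \<H>)"
proof -
  have "finite (PiE \<H> verts)" using assms by (intro finite_PiE) (simp_all add: uniform_hypergraph_def)
  then show ?thesis by (auto simp: uniform_hypergraph_def hypergraph_product_def)
qed

lemma hypergraph_hom_product:
  "H \<in> \<H> \<Longrightarrow> hypergraph_hom (hypergraph_product k \<H>) H (\<lambda>x. x H)"
  by (simp add: hypergraph_hom_def hypergraph_product_def image_subset_iff PiE_iff)

text \<open>For \<open>j = k - 1\<close> and \<open>k\<close>-uniform factors only these sets can
  have neighbours in the product: an edge projects to \<open>k\<close> distinct points in every
  factor, so no two of its vertices share a coordinate.\<close>

definition transversal_nsets :: "nat \<Rightarrow> 'a hypergraph set \<Rightarrow> ('a hypergraph \<Rightarrow> 'a) set set" where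
  "transversal_nsets j \<H> = {S \<in> nsets (PiE \<H> verts) j. \<forall>H\<in>\<H>. inj_on (\<lambda>x. x H) S}"

text \<open>List \<open>N\<close> distinct points of each \<open>C H\<close> and let the
  \<open>j\<close>-th tuple consist of all the \<open>j\<close>-th points.\<close>

lemma transversal_set_exists:
  assumes ne: "\<H> \<noteq> {}" and C: "\<And>H. H \<in> \<H> \<Longrightarrow> finite (C H) \<and> C H \<subseteq> verts H \<and> N \<le> card (C H)"
  shows "\<exists>B \<in> transversal_nsets N \<H>. \<forall>x\<in>B. \<forall>H\<in>\<H>. x H \<in> C H"
proof -
  have "\<exists>b. inj_on b {..<N} \<and> b ` {..<N} \<subseteq> C H" if "H \<in> \<H>" for H
    using inj_on_iff_card_le[of "{..<N}" "C H"] C[OF that] by simp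
  then obtain b where b: "\<And>H. H \<in> \<H> \<Longrightarrow> inj_on (b H) {..<N} \<and> b H ` {..<N} \<subseteq> C H" by metis
  define x where "x = (\<lambda>j. \<lambda>H\<in>\<H>. b H j)"
  have xb: "x j H = b H j" if "H \<in> \<H>" for j H using that by (simp add: x_def)
  have xC: "x j H \<in> C H" if "H \<in> \<H>" "j < N" for j H using b[OF that(1)] that by (auto simp: xb)
  have inj: "inj_on x {..<N}"
  proof (rule inj_onI)
    fix i j assume ij: "i \<in> {..<N}" "j \<in> {..<N}" "x i = x j"
    obtain H where H: "H \<in> \<H>" using ne by blast
    have "b H i = b H j" using fun_cong[OF ij(3), of H] H by (simp add: xb)
    then show "i = j" using b[OF H] ij by (auto dest: inj_onD)
  qed
  show ?thesis
  proof (intro bexI[of _ "x ` {..<N}"])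
    show "\<forall>y\<in>x ` {..<N}. \<forall>H\<in>\<H>. y H \<in> C H" using xC by auto
    have "x j \<in> PiE \<H> verts" if "j < N" for j
    proof (rule PiE_I)
      show "x j H \<in> verts H" if "H \<in> \<H>" for H using xC[OF that \<open>j < N\<close>] C[OF that] by blast
    qed (simp add: x_def)
    moreover have "inj_on (\<lambda>y. y H) (x ` {..<N})" if "H \<in> \<H>" for H
      using b[OF that] xb[OF that] by (auto simp: inj_on_def)
    ultimately show "x ` {..<N} \<in> transversal_nsets N \<H>"
      using inj by (auto simp: transversal_nsets_def nsets_def card_image)
  qed
qed

text \<open>The threshold in use is r (k - 2) + 1, the least size at which every
  \<open>r\<close>-colouring has k - 1 vertices of one colour.\<close>

definition common_nbrs_ge :: "nat \<Rightarrow> nat \<Rightarrow> nat \<Rightarrow> 'a hypergraph \<Rightarrow> bool" where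
  "common_nbrs_ge k r N H \<longleftrightarrow>
     (\<forall>S. (\<forall>i<r. S i \<in> nsets (verts H) (k - 1)) \<longrightarrow> N \<le> card {v \<in> verts H. \<forall>i<r. v \<in> nbrs H (S i)})"

text \<open>Common neighbourhoods pass to the product: project the given sets to each factor, take
  the common neighbourhood there, and choose a transversal set with coordinates in these
  neighbourhoods. The bound on the length is the same for all colourings.\<close>

lemma product_monochromatic_closed_walk:
  assumes k: "k \<ge> 2" and \<H>: "finite \<H>" "\<H> \<noteq> {}"
    and U: "\<And>H. H \<in> \<H> \<Longrightarrow> uniform_hypergraph k H" "\<And>H. H \<in> \<H> \<Longrightarrow> k - 1 \<le> card (verts H)"
    and common: "\<And>H. H \<in> \<H> \<Longrightarrow> common_nbrs_ge k r (r * (k - 2) + 1) H"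
    and c: "\<And>v. c v < r"
  shows "\<exists>w l i. 1 \<le> l \<and> l \<le> card (transversal_nsets (k - 1) \<H>) \<and>
     (\<forall>j. w j \<in> transversal_nsets (k - 1) \<H> \<and> (\<forall>v\<in>w j. c v = i) \<and>
        w (Suc j) \<subseteq> nbrs (hypergraph_product k \<H>) (w j)) \<and> w l = w (0 :: nat)"
proof (rule monochromatic_closed_walk[OF k _ _ _ c])
  let ?P = "hypergraph_product k \<H>"
  have finv: "finite (verts H)" if "H \<in> \<H>" for H using U(1)[OF that] by (simp add: uniform_hypergraph_def)
  then have "finite (PiE \<H> verts)" using \<H> by (simp add: finite_PiE)
  then show "finite (transversal_nsets (k - 1) \<H>)"
    by (simp add: transversal_nsets_def finite_imp_finite_nsets)
  show "transversal_nsets (k - 1) \<H> \<noteq> {}"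
    using transversal_set_exists[OF \<H>(2), of verts "k - 1"] U(2) finv by blast
  fix S assume S: "\<And>i. i < r \<Longrightarrow> S i \<in> transversal_nsets (k - 1) \<H>"
  have SH: "(\<lambda>x. x H) ` S i \<in> nsets (verts H) (k - 1)" if "H \<in> \<H>" "i < r" for H i
    using S[OF that(2)] that(1) by (auto simp: transversal_nsets_def nsets_def card_image PiE_iff)
  define C where "C = (\<lambda>H. {v \<in> verts H. \<forall>i<r. v \<in> nbrs H ((\<lambda>x. x H) ` S i)})"
  have "finite (C H) \<and> C H \<subseteq> verts H \<and> r * (k - 2) + 1 \<le> card (C H)" if H: "H \<in> \<H>" for H
  proof -
    have "r * (k - 2) + 1 \<le> card (C H)"
      using common[OF H, unfolded common_nbrs_ge_def, rule_format, of "\<lambda>i. (\<lambda>x. x H) ` S i", OF SH[OF H]]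
      unfolding C_def by simp
    then show ?thesis using finv[OF H] by (auto simp: C_def)
  qed
  from transversal_set_exists[OF \<H>(2), of C, OF this] obtain B
    where B: "B \<in> transversal_nsets (r * (k - 2) + 1) \<H>" "\<forall>x\<in>B. \<forall>H\<in>\<H>. x H \<in> C H" by blast
  show "\<exists>B. r * (k - 2) < card B \<and> nsets B (k - 1) \<subseteq> transversal_nsets (k - 1) \<H> \<and>
     (\<forall>i<r. B \<subseteq> nbrs ?P (S i))"
  proof (intro exI[of _ B] conjI allI impI subsetI)
    show "r * (k - 2) < card B" using B by (simp add: transversal_nsets_def nsets_def)
    show "T \<in> transversal_nsets (k - 1) \<H>" if "T \<in> nsets B (k - 1)" for T
      using that B(1) unfolding transversal_nsets_def nsets_def
      by (auto intro: inj_on_subset)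
    fix i x assume i: "i < r" and x: "x \<in> B"
    have xC: "x H \<in> nbrs H ((\<lambda>x. x H) ` S i)" if "H \<in> \<H>" for H
      using B(2) x i that by (auto simp: C_def)
    obtain H where H: "H \<in> \<H>" using \<H> by blast
    have "card ((\<lambda>x. x H) ` S i) < k" using SH[OF H i] k by (simp add: nsets_def)
    then have "x H \<notin> (\<lambda>x. x H) ` S i" using nbrs_notin[OF U(1)[OF H]] xC[OF H] by blast
    then have "x \<notin> S i" by blast
    then have "insert x (S i) \<in> nsets (PiE \<H> verts) k"
      using S[OF i] x B(1) k by (auto simp: transversal_nsets_def nsets_def)
    moreover have "(\<lambda>x. x H) ` insert x (S i) \<in> edges H" if "H \<in> \<H>" for H
      using xC[OF that] by (simp add: nbrs_def)
    ultimately show "x \<in> nbrs ?P (S i)"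
      unfolding nbrs_def hypergraph_product_def by simp
  qed
qed

section \<open>The residue construction\<close>

text \<open>The vertex \<open>v\<close> has class \<open>v mod r\<close> and label \<open>v div r\<close>, read modulo \<open>M\<close>.\<close>

definition residue_hypergraph :: "nat \<Rightarrow> nat \<Rightarrow> nat \<Rightarrow> nat \<Rightarrow> nat hypergraph" where
  "residue_hypergraph k r M n = \<lparr>verts = {..<n}, edges = {e \<in> nsets {..<n} k.
     (\<exists>i. \<forall>v\<in>e. v mod r = i) \<longrightarrow> int M dvd (\<Sum>v\<in>e. int (v div r)) - 1}\<rparr>"

lemma uniform_residue_hypergraph: "uniform_hypergraph k (residue_hypergraph k r M n)"
  by (auto simp: residue_hypergraph_def uniform_hypergraph_def)

lemma verts_residue_hypergraph [simp]: "verts (residue_hypergraph k r M n) = {..<n}"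
  by (simp add: residue_hypergraph_def)

text \<open>Class and label modulo \<open>M\<close> fix \<open>v\<close> modulo r M, so the quotient
  \<open>v div (r * M)\<close> determines \<open>v\<close>.\<close>

lemma card_residue_class:
  assumes r: "r \<ge> 1" and M: "M \<ge> 1"
  shows "card {v \<in> {..<n}. v mod r = i \<and> (v div r) mod M = z} \<le> n div (r * M) + 1"
proof -
  have "card {v \<in> {..<n}. v mod r = i \<and> (v div r) mod M = z} \<le> card {..n div (r * M)}"
  proof (rule card_inj_on_le)
    show "inj_on (\<lambda>v. v div (r * M)) {v \<in> {..<n}. v mod r = i \<and> (v div r) mod M = z}"
    proof (rule inj_onI)
      fix v w assume v: "v \<in> {v \<in> {..<n}. v mod r = i \<and> (v div r) mod M = z}"
        and w: "w \<in> {v \<in> {..<n}. v mod r = i \<and> (v div r) mod M = z}"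
        and eq: "v div (r * M) = w div (r * M)"
      have "v div r = w div r"
        using v w eq by (metis (mono_tags, lifting) div_mult2_eq div_mult_mod_eq mem_Collect_eq)
      then show "v = w" using v w by (metis (mono_tags, lifting) div_mult_mod_eq mem_Collect_eq)
    qed
    show "(\<lambda>v. v div (r * M)) ` {v \<in> {..<n}. v mod r = i \<and> (v div r) mod M = z} \<subseteq> {..n div (r * M)}"
      by (auto intro: div_le_mono)
  qed simp
  then show ?thesis by simp
qed

text \<open>A vertex outside \<open>S\<close> can fail to be a neighbour only if it lies in the same
  class as all of \<open>S\<close> and has one of the \<open>M - 1\<close> wrong labels.\<close>

lemma min_codegree_residue_hypergraph:
  assumes k: "k \<ge> 2" and r: "r \<ge> 1" and M: "M \<ge> 1" and n: "k - 1 \<le> n"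
  shows "n - ((k - 1) + (M - 1) * (n div (r * M) + 1)) \<le> min_codegree k (residue_hypergraph k r M n)"
    (is "_ \<le> min_codegree k ?H")
proof (rule min_codegree_ge[OF uniform_residue_hypergraph])
  fix S assume "S \<in> nsets (verts ?H) (k - 1)"
  then have S: "S \<subseteq> {..<n}" "finite S" "card S = k - 1" by (auto simp: nsets_def)
  then have Sne: "S \<noteq> {}" using k by auto
  define \<sigma> where "\<sigma> = (\<Sum>v\<in>S. int (v div r))"
  define z where "z = nat ((1 - \<sigma>) mod int M)"
  have z: "int z = (1 - \<sigma>) mod int M" "z < M" using M by (simp_all add: z_def nat_less_iff)
  \<comment> \<open>The class of \<open>s\<close> is the only one that can contain all of
    \<open>insert v S\<close>, so there is no need to distinguish whether \<open>S\<close> lies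
    inside a class.\<close>
  obtain s where s: "s \<in> S" using Sne by blast
  define Bad where "Bad = (\<Union>y\<in>{..<M} - {z}. {v \<in> {..<n}. v mod r = s mod r \<and> (v div r) mod M = y})"
  have "card Bad \<le> (\<Sum>y\<in>{..<M} - {z}. card {v \<in> {..<n}. v mod r = s mod r \<and> (v div r) mod M = y})"
    unfolding Bad_def by (rule card_UN_le) simp
  also have "\<dots> \<le> (\<Sum>y\<in>{..<M} - {z}. n div (r * M) + 1)"
    by (intro sum_mono card_residue_class r M)
  also have "\<dots> = (M - 1) * (n div (r * M) + 1)" using z by simp
  finally have cBad: "card Bad \<le> (M - 1) * (n div (r * M) + 1)" .
  have fBad: "finite Bad" by (simp add: Bad_def)
  have "{..<n} - (S \<union> Bad) \<subseteq> nbrs ?H S"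
  proof
    fix v assume v: "v \<in> {..<n} - (S \<union> Bad)"
    have "insert v S \<in> nsets {..<n} k" using S v k by (auto simp: nsets_def)
    moreover have "int M dvd (\<Sum>x\<in>insert v S. int (x div r)) - 1" if "\<exists>i. \<forall>x\<in>insert v S. x mod r = i"
    proof -
      have "v mod r = s mod r" using that s by auto
      then have "(v div r) mod M = z" using v M unfolding Bad_def by simp
      then have "int (v div r) mod int M = (1 - \<sigma>) mod int M" using z(1) by (simp flip: zmod_int)
      then have "int M dvd int (v div r) - (1 - \<sigma>)" by (simp add: mod_eq_dvd_iff)
      moreover have "(\<Sum>x\<in>insert v S. int (x div r)) = int (v div r) + \<sigma>" using S v by (simp add: \<sigma>_def)
      ultimately show ?thesis by (simp add: algebra_simps)
    qed
    ultimately show "v \<in> nbrs ?H S" by (simp add: nbrs_def residue_hypergraph_def)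
  qed
  then have "card ({..<n} - (S \<union> Bad)) \<le> card (nbrs ?H S)"
    by (intro card_mono finite_nbrs[OF uniform_residue_hypergraph])
  moreover have "card {..<n} - card (S \<union> Bad) \<le> card ({..<n} - (S \<union> Bad))"
    using S fBad by (intro diff_card_le_card_Diff) simp
  moreover have "card (S \<union> Bad) \<le> (k - 1) + (M - 1) * (n div (r * M) + 1)"
    using card_Un_le[of S Bad] cBad S by linarith
  ultimately show "n - ((k - 1) + (M - 1) * (n div (r * M) + 1)) \<le> card (nbrs ?H S)"
    by simp
qed (use k n in auto)

text \<open>The substitution \<open>t = k s - (k - 1)\<close> makes the affine recursion linear, with multiplier
  \<open>1 - k\<close>, and improves the modulus from \<open>M\<close> to \<open>k M\<close>.\<close>

lemma no_closed_affine_orbit: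
  fixes k :: int and s :: "nat \<Rightarrow> int"
  assumes k: "k \<ge> 3" and l: "1 \<le> l" "l \<le> L" and M: "M = (\<Prod>j\<in>{1..L}. (1 - k) ^ j - 1)"
    and step: "\<And>j. M dvd s (Suc j) - (k - 1) * (1 - s j)" and closed: "s l = s 0"
  shows False
proof -
  define t where "t = (\<lambda>j. k * s j - (k - 1))"
  have rec: "k * M dvd t (Suc j) - (1 - k) * t j" for j
  proof -
    have "t (Suc j) - (1 - k) * t j = k * (s (Suc j) - (k - 1) * (1 - s j))"
      by (simp add: t_def algebra_simps)
    then show ?thesis using step[of j] by simp
  qed
  have "k * M dvd t j - (1 - k) ^ j * t 0" for j
  proof (induction j)
    case (Suc j)
    have "k * M dvd (t (Suc j) - (1 - k) * t j) + (1 - k) * (t j - (1 - k) ^ j * t 0)"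
      using rec Suc by (intro dvd_add dvd_mult)
    then show ?case by (simp add: algebra_simps)
  qed simp
  from this[of l] have "k * M dvd t 0 - (1 - k) ^ l * t 0" using closed by (simp add: t_def)
  then have dvd: "k * M dvd ((1 - k) ^ l - 1) * t 0"
    by (subst dvd_minus_iff[symmetric]) (simp add: algebra_simps)
  have "(1 - k) ^ l - 1 dvd M" unfolding M by (rule dvd_prodI) (use l in auto)
  then obtain q where q: "M = ((1 - k) ^ l - 1) * q" by blast
  \<comment> \<open>Here \<open>k \<ge> 3\<close> enters: for k = 2 the multiplier would be -1,
    whose square is 1.\<close>
  have "(1 - k) ^ l \<noteq> 1"
  proof
    assume "(1 - k) ^ l = 1"
    then have "\<bar>1 - k\<bar> ^ l = 1" by (simp add: power_abs[symmetric])
    moreover have "1 < \<bar>1 - k\<bar> ^ l" using k l by (intro one_less_power) auto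
    ultimately show False by simp
  qed
  \<comment> \<open>Cancelling (1 - k)^l - 1 leaves the factor \<open>k\<close> of the improved
    modulus, whereas \<open>t 0\<close> is congruent to 1 modulo \<open>k\<close>.\<close>
  then have "k * q dvd t 0" using dvd unfolding q
    by (simp add: mult.left_commute[of k])
  then have "k dvd t 0" by (rule dvd_mult_left)
  then have "k dvd k * s 0 - t 0" by (intro dvd_diff) auto
  then have "k dvd k - 1" by (simp add: t_def)
  then show False using k zdvd_not_zless[of "k - 1" k] by simp
qed

text \<open>A copy colours the vertices of \<open>F\<close> by the classes of their images. Along a
  monochromatic walk each vertex of \<open>w (Suc j)\<close> has label congruent to 1 - s j, and
  summing over its k - 1 vertices gives the affine recursion, which has no closed orbit of length at
  most \<open>L\<close>.\<close>

lemma residue_hypergraph_free: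
  assumes k: "k \<ge> 3" and r: "r \<ge> 1" and F: "uniform_hypergraph k F"
    and walk: "\<And>c. (\<And>v. c v < r) \<Longrightarrow> \<exists>w l i. 1 \<le> l \<and> l \<le> L \<and>
     (\<forall>j. w j \<in> nsets (verts F) (k - 1) \<and> (\<forall>v\<in>w j. c v = i) \<and> w (Suc j) \<subseteq> nbrs F (w j)) \<and>
     w l = w (0 :: nat)"
    and M: "int M = \<bar>\<Prod>j\<in>{1..L}. (1 - int k) ^ j - 1\<bar>"
  shows "\<not> contains_copy (residue_hypergraph k r M n) F"
proof
  assume "contains_copy (residue_hypergraph k r M n) F"
  then obtain p where p: "inj_on p (verts F)"
    and pe: "\<And>e. e \<in> edges F \<Longrightarrow> p ` e \<in> edges (residue_hypergraph k r M n)"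
    by (auto simp: contains_copy_def)
  have "p v mod r < r" for v using r by simp
  from walk[of "\<lambda>v. p v mod r", OF this] obtain w l i where l: "1 \<le> l" "l \<le> L" and closed: "w l = w (0 :: nat)"
    and wS: "\<And>j. w j \<in> nsets (verts F) (k - 1)" and wc: "\<And>j v. v \<in> w j \<Longrightarrow> p v mod r = i"
    and wn: "\<And>j. w (Suc j) \<subseteq> nbrs F (w j)" by blast
  define z where "z = (\<lambda>v. int (p v div r))"
  define s where "s = (\<lambda>j. \<Sum>v\<in>w j. z v)"
  have w: "finite (w j)" "card (w j) = k - 1" "w j \<subseteq> verts F" for j
    using wS[of j] by (auto simp: nsets_def)
  have "int M dvd s (Suc j) - (int k - 1) * (1 - s j)" for j
  proof -
    have "int M dvd z v - (1 - s j)" if v: "v \<in> w (Suc j)" for v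
    proof -
      have vn: "v \<in> nbrs F (w j)" using v wn by blast
      then have e: "insert v (w j) \<in> edges F" by (simp add: nbrs_def)
      have "v \<notin> w j" using nbrs_notin[OF F _ vn] w k by simp
      have sub: "insert v (w j) \<subseteq> verts F" using uniform_edgeD(1)[OF F e] .
      have "\<exists>i. \<forall>x\<in>p ` insert v (w j). x mod r = i" using wc v by blast
      then have "int M dvd (\<Sum>x\<in>p ` insert v (w j). int (x div r)) - 1"
        using pe[OF e] unfolding residue_hypergraph_def by simp
      also have "(\<Sum>x\<in>p ` insert v (w j). int (x div r)) = (\<Sum>x\<in>insert v (w j). z x)"
        unfolding z_def using sum.reindex[OF inj_on_subset[OF p sub]] by (simp add: o_def)
      also have "\<dots> = z v + s j" using \<open>v \<notin> w j\<close> w by (simp add: s_def)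
      finally show ?thesis by (simp add: algebra_simps)
    qed
    then have "int M dvd (\<Sum>v\<in>w (Suc j). z v - (1 - s j))" by (rule dvd_sum)
    also have "(\<Sum>v\<in>w (Suc j). z v - (1 - s j)) = s (Suc j) - (int k - 1) * (1 - s j)"
      using k w by (simp add: s_def sum_subtractf of_nat_diff)
    finally show ?thesis .
  qed
  then have "(\<Prod>j\<in>{1..L}. (1 - int k) ^ j - 1) dvd s (Suc j) - (int k - 1) * (1 - s j)" for j
    using M by simp
  moreover have "s l = s 0" using closed by (simp add: s_def)
  ultimately show False using no_closed_affine_orbit[of "int k" l L _ s, OF _ l refl] k by simp
qed

text \<open>Since \<open>L\<close> is the same for all colourings, one modulus \<open>M\<close>
  excludes every copy of \<open>F\<close>, for all \<open>n\<close> at once.\<close>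

lemma codegree_density_gt:
  assumes k: "k \<ge> 3" and r: "r \<ge> 1" and F: "uniform_hypergraph k F"
    and walk: "\<And>c. (\<And>v. c v < r) \<Longrightarrow> \<exists>w l i. 1 \<le> l \<and> l \<le> L \<and>
     (\<forall>j. w j \<in> nsets (verts F) (k - 1) \<and> (\<forall>v\<in>w j. c v = i) \<and> w (Suc j) \<subseteq> nbrs F (w j)) \<and>
     w l = w (0 :: nat)"
  shows "(real r - 1) / real r < codegree_density k F"
proof -
  \<comment> \<open>The product may be negative; its absolute value has the same multiples.\<close>
  define M where "M = nat \<bar>\<Prod>j\<in>{1..L}. (1 - int k) ^ j - 1\<bar>"
  have M: "int M = \<bar>\<Prod>j\<in>{1..L}. (1 - int k) ^ j - 1\<bar>" by (simp add: M_def)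
  have "(1 - int k) ^ j \<noteq> 1" if "1 \<le> j" for j
  proof
    assume "(1 - int k) ^ j = 1"
    then have "\<bar>1 - int k\<bar> ^ j = 1" by (simp add: power_abs[symmetric])
    moreover have "1 < \<bar>1 - int k\<bar> ^ j" using k that by (intro one_less_power) auto
    ultimately show False by simp
  qed
  then have "(\<Prod>j\<in>{1..L}. (1 - int k) ^ j - 1) \<noteq> 0" by simp
  then have M1: "M \<ge> 1" using M by linarith
  \<comment> \<open>The limiting fraction of excluded vertices; 1 - q equals (r - 1) / r + 1 / (r
    M).\<close>
  define q where "q = (real M - 1) / (real r * real M)"
  have bound: "(1 - q) - real (k + M) / real n \<le> real (ex_co k n F) / real n" if n: "k \<le> n" for n
  proof -
    have "n - ((k - 1) + (M - 1) * (n div (r * M) + 1)) \<le> min_codegree k (residue_hypergraph k r M n)"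
      using min_codegree_residue_hypergraph[OF _ r M1, of k n] k n by simp
    also have "\<dots> \<le> ex_co k n F"
      using k by (intro ex_co_ge uniform_residue_hypergraph residue_hypergraph_free[OF k r F walk M]) auto
    finally have "n \<le> ex_co k n F + ((k - 1) + (M - 1) * (n div (r * M) + 1))" by simp
    then have "real n \<le> real (ex_co k n F + ((k - 1) + (M - 1) * (n div (r * M) + 1)))"
      by (simp only: of_nat_le_iff)
    also have "\<dots> = real (ex_co k n F) + (real k - 1) + (real M - 1) * real (n div (r * M)) + (real M - 1)"
    proof -
      have "real (k - 1) = real k - 1" "real (M - 1) = real M - 1" using k M1 by (simp_all add: of_nat_diff)
      then show ?thesis unfolding of_nat_add of_nat_mult by (simp add: distrib_left)
    qed
    also have "(real M - 1) * real (n div (r * M)) \<le> (real M - 1) * (real n / real (r * M))"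
      using M1 of_nat_div_le_of_nat[of n "r * M", where 'a = real] by (intro mult_left_mono) auto
    also have "\<dots> = q * real n" by (simp add: q_def)
    finally have "(1 - q) * real n - real (k + M) \<le> real (ex_co k n F)" by (simp add: algebra_simps)
    then have "((1 - q) * real n - real (k + M)) / real n \<le> real (ex_co k n F) / real n"
      by (rule divide_right_mono) simp
    then show ?thesis using n k by (simp add: diff_divide_distrib)
  qed
  have "(\<lambda>n. (1 - q) - real (k + M) / real n) \<longlonglongrightarrow> (1 - q) - 0"
    by (intro tendsto_diff tendsto_const lim_const_over_n)
  then have "1 - q \<le> codegree_density k F"
    using LIMSEQ_le[OF _ codegree_density_limit[of k F], of _ "1 - q"] bound k by auto
  moreover have "(real r - 1) / real r < 1 - q"
    using r M1 by (simp add: q_def field_simps)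
  ultimately show ?thesis by simp
qed

section \<open>Common neighbourhoods and the choice of the product\<close>

text \<open>Each \<open>S i\<close> has at most (1 / r - \<epsilon>) m non-neighbours, so
  \<open>r\<close> of these sets together exclude at most m - r \<epsilon> m vertices.\<close>

lemma common_nbrs_ge_of_codegree:
  assumes H: "uniform_hypergraph k H" "verts H = {..<m}" and k: "k \<ge> 1" and r: "r \<ge> 1"
    and d: "((real r - 1) / real r + \<epsilon>) * real m \<le> min_codegree k H" and N: "real N \<le> real r * \<epsilon> * real m"
  shows "common_nbrs_ge k r N H"
  unfolding common_nbrs_ge_def
proof (intro allI impI)
  fix S assume S: "\<forall>i<r. S i \<in> nsets (verts H) (k - 1)"
  define C where "C = {v \<in> verts H. \<forall>i<r. v \<in> nbrs H (S i)}"
  have "{..<m} - C \<subseteq> (\<Union>i<r. {..<m} - nbrs H (S i))" using H(2) by (auto simp: C_def)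
  then have "card ({..<m} - C) \<le> card (\<Union>i<r. {..<m} - nbrs H (S i))" by (intro card_mono) auto
  also have "\<dots> \<le> (\<Sum>i<r. card ({..<m} - nbrs H (S i)))" by (rule card_UN_le) simp
  also have "\<dots> \<le> (\<Sum>i<r. m - min_codegree k H)"
  proof (rule sum_mono)
    fix i assume "i \<in> {..<r}"
    then have "min_codegree k H \<le> card (nbrs H (S i))" using S min_codegree_le[OF H(1) k] by simp
    then show "card ({..<m} - nbrs H (S i)) \<le> m - min_codegree k H"
      using nbrs_subset[OF H(1), of "S i"] finite_nbrs[OF H(1)] H(2) by (simp add: card_Diff_subset)
  qed
  finally have le: "card ({..<m} - C) \<le> r * (m - min_codegree k H)" by simp
  have "C \<subseteq> {..<m}" using H(2) by (auto simp: C_def)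
  then have "card ({..<m} - C) = m - card C" "card C \<le> m"
    using finite_subset[of C "{..<m}"] card_mono[of "{..<m}" C] by (auto simp: card_Diff_subset)
  then have "real m - real (card C) = real (card ({..<m} - C))" by (simp add: of_nat_diff)
  also have "\<dots> \<le> real (r * (m - min_codegree k H))" using le by (simp only: of_nat_le_iff)
  also have "\<dots> = real r * (real m - real (min_codegree k H))"
    using min_codegree_le_card[OF H(1) k] H(2) by (simp add: of_nat_diff)
  also have "\<dots> \<le> real r * (real m - ((real r - 1) / real r + \<epsilon>) * real m)"
    using d by (intro mult_left_mono) auto
  also have "\<dots> = real m - real r * \<epsilon> * real m" using r by (simp add: field_simps)
  finally have "real N \<le> real (card C)" using N by linarith
  then show "N \<le> card {v \<in> verts H. \<forall>i<r. v \<in> nbrs H (S i)}" by (simp add: C_def)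
qed

text \<open>This ensures that the family of factors is not empty.\<close>

lemma common_nbrs_ge_complete:
  assumes k: "k \<ge> 1" and m: "r * (k - 1) + N \<le> m"
  shows "common_nbrs_ge k r N \<lparr>verts = {..<m}, edges = nsets {..<m} k\<rparr>" (is "common_nbrs_ge k r N ?K")
  unfolding common_nbrs_ge_def
proof (intro allI impI)
  fix S assume S: "\<forall>i<r. S i \<in> nsets (verts ?K) (k - 1)"
  have Si: "S i \<subseteq> {..<m}" "finite (S i)" "card (S i) = k - 1" if "i < r" for i
    using S that by (auto simp: nsets_def)
  have "card (\<Union>i<r. S i) \<le> (\<Sum>i<r. card (S i))" by (rule card_UN_le) simp
  also have "\<dots> = r * (k - 1)" using Si by simp
  finally have "N \<le> card {..<m} - card (\<Union>i<r. S i)" using m by simp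
  also have "\<dots> \<le> card ({..<m} - (\<Union>i<r. S i))"
    using Si by (intro diff_card_le_card_Diff) auto
  also have "\<dots> \<le> card {v \<in> verts ?K. \<forall>i<r. v \<in> nbrs ?K (S i)}"
    using Si k by (intro card_mono) (auto simp: nbrs_def nsets_def)
  finally show "N \<le> card {v \<in> verts ?K. \<forall>i<r. v \<in> nbrs ?K (S i)}" .
qed

theorem theorem1p2:
  fixes k r :: nat
  assumes "k \<ge> 3" and "r \<ge> 1"
  shows "codegree_densities k \<subseteq> {0..<1} \<and>
         ((real r - 1) / real r) islimpt codegree_densities k"
proof
  have k: "k \<ge> 1" "k \<ge> 2" using assms by auto
  show "codegree_densities k \<subseteq> {0..<1}"
    using codegree_density_nonneg[OF k(1)] codegree_density_less_1[OF k(1)]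
    by (auto simp: codegree_densities_def)
  show "((real r - 1) / real r) islimpt codegree_densities k"
    unfolding islimpt_approachable
  proof (intro allI impI)
    fix e :: real assume e: "0 < e"
    \<comment> \<open>One \<epsilon> is the excess of the codegree over (r - 1) / r, another is lost
      in the upper bound by homomorphisms.\<close>
    define \<epsilon> where "\<epsilon> = min 1 (e / 3)"
    have \<epsilon>: "0 < \<epsilon>" "\<epsilon> \<le> 1" "2 * \<epsilon> < e" using e by (auto simp: \<epsilon>_def)
    let ?\<alpha> = "(real r - 1) / real r + \<epsilon>"
    define N where "N = r * (k - 2) + 1"
    obtain m0 where m0: "\<forall>m\<ge>m0. \<forall>\<alpha>\<ge>0. \<forall>F :: (nat hypergraph \<Rightarrow> nat) hypergraph. uniform_hypergraph k F \<longrightarrow>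
      (\<forall>H. uniform_hypergraph k H \<longrightarrow> verts H = {..<m} \<longrightarrow> \<alpha> * real m \<le> min_codegree k H \<longrightarrow>
       (\<exists>h. hypergraph_hom F H h)) \<longrightarrow> codegree_density k F \<le> \<alpha> + \<epsilon>"
      using codegree_density_le_of_hom[OF k(1) \<epsilon>(1,2)] ..
    \<comment> \<open>The bounds serve, in this order, the upper bound on the density, the size of
      common neighbourhoods, and the complete hypergraph. As \<open>m0\<close> does not depend on
      the hypergraph, \<open>F\<close> may be built from \<open>m\<close>.\<close>
    define m where "m = max (max m0 (nat \<lceil>real N / (real r * \<epsilon>)\<rceil>)) (r * (k - 1) + N + k)"
    have m: "m0 \<le> m" "r * (k - 1) + N \<le> m" "k - 1 \<le> m" by (auto simp: m_def)
    have "real N / (real r * \<epsilon>) \<le> real m" unfolding m_def by linarith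
    then have mN: "real N \<le> real r * \<epsilon> * real m" using \<epsilon> assms by (simp add: field_simps)
    \<comment> \<open>Membership asks for common neighbourhoods, not for large codegree: this
      follows from the codegree bound and, unlike that bound, survives in the product.\<close>
    define \<H> where "\<H> = {H :: nat hypergraph. (uniform_hypergraph k H \<and> verts H = {..<m}) \<and> common_nbrs_ge k r N H}"
    have fin: "finite \<H>"
      unfolding \<H>_def by (rule finite_subset[OF _ finite_uniform_hypergraphs[of "{..<m}" k]]) auto
    have "\<lparr>verts = {..<m}, edges = nsets {..<m} k\<rparr> \<in> \<H>"
      using common_nbrs_ge_complete[OF k(1) m(2)] by (simp add: \<H>_def uniform_hypergraph_def)
    then have ne: "\<H> \<noteq> {}" by blast
    have U: "uniform_hypergraph k H" "k - 1 \<le> card (verts H)" "common_nbrs_ge k r (r * (k - 2) + 1) H"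
      if "H \<in> \<H>" for H using that m by (auto simp: \<H>_def N_def)
    define F where "F = hypergraph_product k \<H>"
    have F: "uniform_hypergraph k F" unfolding F_def by (rule uniform_hypergraph_product[OF fin U(1)])
    have "codegree_density k F \<le> ?\<alpha> + \<epsilon>"
    proof (rule m0[rule_format, OF m(1) _ F])
      show "0 \<le> ?\<alpha>" using assms \<epsilon> by simp
      fix H :: "nat hypergraph"
      assume H: "uniform_hypergraph k H" "verts H = {..<m}" "?\<alpha> * real m \<le> min_codegree k H"
      have "H \<in> \<H>" unfolding \<H>_def
        using H common_nbrs_ge_of_codegree[OF H(1,2) k(1) assms(2) H(3) mN] by blast
      then show "\<exists>h. hypergraph_hom F H h" unfolding F_def using hypergraph_hom_product by blast
    qed
    moreover have "(real r - 1) / real r < codegree_density k F"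
    proof (rule codegree_density_gt[OF assms F])
      fix c :: "(nat hypergraph \<Rightarrow> nat) \<Rightarrow> nat" assume c: "\<And>v. c v < r"
      have "\<exists>w l i. 1 \<le> l \<and> l \<le> card (transversal_nsets (k - 1) \<H>) \<and>
          (\<forall>j. w j \<in> transversal_nsets (k - 1) \<H> \<and> (\<forall>v\<in>w j. c v = i) \<and>
          w (Suc j) \<subseteq> nbrs F (w j)) \<and> w l = w (0 :: nat)"
        unfolding F_def
        by (rule product_monochromatic_closed_walk[where r = r and c = c, OF k(2) fin ne U(1) U(2) U(3) c])
      then obtain w l i where w: "1 \<le> l" "l \<le> card (transversal_nsets (k - 1) \<H>)" "w l = w (0 :: nat)"
        and wj: "\<forall>j. w j \<in> transversal_nsets (k - 1) \<H> \<and> (\<forall>v\<in>w j. c v = i) \<and>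
          w (Suc j) \<subseteq> nbrs F (w j)" by (elim exE conjE) blast
      have "transversal_nsets (k - 1) \<H> \<subseteq> nsets (verts F) (k - 1)"
        by (auto simp: transversal_nsets_def F_def hypergraph_product_def)
      then have "\<forall>j. w j \<in> nsets (verts F) (k - 1) \<and> (\<forall>v\<in>w j. c v = i) \<and> w (Suc j) \<subseteq> nbrs F (w j)"
        using wj by blast
      with w show "\<exists>w l i. 1 \<le> l \<and> l \<le> card (transversal_nsets (k - 1) \<H>) \<and>
         (\<forall>j. w j \<in> nsets (verts F) (k - 1) \<and> (\<forall>v\<in>w j. c v = i) \<and> w (Suc j) \<subseteq> nbrs F (w j)) \<and>
         w l = w (0 :: nat)"
        by (intro exI[of _ w] exI[of _ l] exI[of _ i] conjI)
    qed
    \<comment> \<open>The lower bound is strict, so the density found differs from (r - 1) /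
      r.\<close>
    ultimately show "\<exists>x'\<in>codegree_densities k. x' \<noteq> (real r - 1) / real r \<and> dist x' ((real r - 1) / real r) < e"
      using codegree_density_mem[OF F] \<epsilon>(3)
      by (intro bexI[of _ "codegree_density k F"]) (auto simp: dist_real_def)
  qed
qed

end
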